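(* A tree poset $\mathcal{P}$ is a mobile tree poset if and only if there exists a set $F$ of cover relations of $\mathcal{P}$ such that the fold $\mathcal{P}_F$ is a rooted tree poset and the component tree $C(\mathcal{P}_F)$ is a path.
   Context: A tree poset is a finite poset whose Hasse diagram is a tree; a rooted tree poset is a tree poset with a unique maximal element. $x\lessdot y$ means $y$ covers $x$; a cover relation is recorded as $(x,y)$. Ribbons: $\mathcal{Z}^{(\ell)}_S$ ($S\subset[\ell-1]$) is the poset on $z_1,\dots,z_\ell$ with cover relations $z_{i+1}\lessdot z_i$ for $i\in S$ and $z_i\lessdot z_{i+1}$ for $i\notin S$. Mobile tree posets: posets obtained from a ribbon $\mathcal{Z}$ by (i) for each $z\in\mathcal{Z}$ attaching $m_z\ge0$ pairwise disjoint rooted tree posets by making $z$ cover each of their roots; (ii) for at most one $z'\in\mathcal{Z}$, attaching a further disjoint rooted tree poset $\mathcal{Q}$ by adding the relation $z'\lessdot q$ for some element $q\in\mathcal{Q}$; taking transitive closures. Folds: for a set $F$ of cover relations of $\mathcal{P}$, $\mathcal{P}\ominus F$ is the poset on the same set whose order is generated by the cover relations not in $F$; the fold $\mathcal{P}_F$ is obtained from $\mathcal{P}\ominus F$ by adding $y<x$ for every $(x,y)\in F$ and taking the transitive closure. The component tree $C(\mathcal{P}_F)$ is the graph whose vertices are the connected components (of the Hasse diagram) of $\mathcal{P}\ominus F$, with an edge joining the components of $x$ and $y$ for each $(x,y)\in F$. *)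

theory Defs
  imports Main "HOL-Library.Disjoint_Sets"
begin

text \<open>A graph is a pair of a vertex set and a set of unordered edges. The notion of tree in the
  AFP entry Graph_Theory only forbids directed cycles, so it does not apply to Hasse diagrams.\<close>

type_synonym 'v ugraph = "'v set \<times> 'v set set"

definition adj_rel :: "'v ugraph \<Rightarrow> 'v rel" where
  "adj_rel G = {(u, v). u \<in> fst G \<and> v \<in> fst G \<and> {u, v} \<in> snd G}"

definition component_of :: "'v ugraph \<Rightarrow> 'v \<Rightarrow> 'v set" where
  "component_of G u = {v \<in> fst G. (u, v) \<in> (adj_rel G)\<^sup>*}"

definition graph_components :: "'v ugraph \<Rightarrow> 'v set set" where
  "graph_components G = component_of G ` fst G"

definition connected_graph :: "'v ugraph \<Rightarrow> bool" where
  "connected_graph G \<longleftrightarrow> fst G \<noteq> {} \<and> (\<forall>u\<in>fst G. \<forall>v\<in>fst G. (u, v) \<in> (adj_rel G)\<^sup>*)"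

definition is_cycle :: "'v ugraph \<Rightarrow> 'v list \<Rightarrow> bool" where
  "is_cycle G vs \<longleftrightarrow> 3 \<le> length vs \<and> distinct vs \<and>
     (\<forall>i. Suc i < length vs \<longrightarrow> (vs ! i, vs ! Suc i) \<in> adj_rel G) \<and>
     (last vs, hd vs) \<in> adj_rel G"

definition tree_graph :: "'v ugraph \<Rightarrow> bool" where
  "tree_graph G \<longleftrightarrow> connected_graph G \<and> (\<nexists>vs. is_cycle G vs)"

definition path_graph :: "'v ugraph \<Rightarrow> bool" where
  "path_graph G \<longleftrightarrow> (\<exists>vs. vs \<noteq> [] \<and> distinct vs \<and> fst G = set vs \<and>
     snd G = {{vs ! i, vs ! Suc i} | i. Suc i < length vs})"

text \<open>A poset is given by its ground set and its (reflexive) order relation;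
  \<^term>\<open>(x, y) \<in> snd P\<close> stands for \<open>x \<le> y\<close>.\<close>

type_synonym 'a poset = "'a set \<times> 'a rel"

definition finite_poset :: "'a poset \<Rightarrow> bool" where
  "finite_poset P \<longleftrightarrow> finite (fst P) \<and> partial_order_on (fst P) (snd P)"

definition generated_poset :: "'a set \<Rightarrow> 'a rel \<Rightarrow> 'a poset" where
  "generated_poset A R = (A, Id_on A \<union> R\<^sup>+)"

definition covers :: "'a poset \<Rightarrow> 'a rel" where
  "covers P = {(x, y). (x, y) \<in> snd P \<and> x \<noteq> y \<and>
     (\<nexists>w. w \<noteq> x \<and> w \<noteq> y \<and> (x, w) \<in> snd P \<and> (w, y) \<in> snd P)}"

definition hasse :: "'a poset \<Rightarrow> 'a ugraph" where
  "hasse P = (fst P, {{x, y} | x y. (x, y) \<in> covers P})"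

definition tree_poset :: "'a poset \<Rightarrow> bool" where
  "tree_poset P \<longleftrightarrow> finite_poset P \<and> tree_graph (hasse P)"

definition maximal_in :: "'a poset \<Rightarrow> 'a \<Rightarrow> bool" where
  "maximal_in P x \<longleftrightarrow> x \<in> fst P \<and> (\<forall>y\<in>fst P. (x, y) \<in> snd P \<longrightarrow> y = x)"

definition rooted_tree_poset :: "'a poset \<Rightarrow> bool" where
  "rooted_tree_poset P \<longleftrightarrow> tree_poset P \<and> (\<exists>!x. maximal_in P x)"

definition poset_root :: "'a poset \<Rightarrow> 'a" where
  "poset_root P = (THE x. maximal_in P x)"

definition ribbon :: "nat \<Rightarrow> nat set \<Rightarrow> (nat \<Rightarrow> 'a) \<Rightarrow> 'a poset" where
  "ribbon l S z = generated_poset (z ` {1..l})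
     ({(z (Suc i), z i) | i. i \<in> S} \<union> {(z i, z (Suc i)) | i. i \<in> {1..l-1} - S})"

text \<open>The posets \<^term>\<open>T i j\<close> with \<^term>\<open>j < m i\<close> are those attached below \<^term>\<open>z i\<close>.\<close>

definition attach_below ::
    "'a poset \<Rightarrow> nat \<Rightarrow> (nat \<Rightarrow> 'a) \<Rightarrow> (nat \<Rightarrow> nat) \<Rightarrow> (nat \<Rightarrow> nat \<Rightarrow> 'a poset) \<Rightarrow> 'a poset" where
  "attach_below Z l z m T = generated_poset
     (fst Z \<union> (\<Union>i\<in>{1..l}. \<Union>j\<in>{..<m i}. fst (T i j)))
     (snd Z \<union> (\<Union>i\<in>{1..l}. \<Union>j\<in>{..<m i}. snd (T i j) \<union> {(poset_root (T i j), z i)}))"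

definition attach_above :: "'a poset \<Rightarrow> 'a \<Rightarrow> 'a poset \<Rightarrow> 'a \<Rightarrow> 'a poset" where
  "attach_above B x Q q = generated_poset (fst B \<union> fst Q) (snd B \<union> snd Q \<union> {(x, q)})"

definition mobile_tree_poset :: "'a poset \<Rightarrow> bool" where
  "mobile_tree_poset P \<longleftrightarrow> (\<exists>l S z m T. 1 \<le> l \<and> S \<subseteq> {1..l-1} \<and> inj_on z {1..l} \<and>
     (\<forall>i\<in>{1..l}. \<forall>j<m i. rooted_tree_poset (T i j) \<and> fst (T i j) \<inter> z ` {1..l} = {}) \<and>
     disjoint_family_on (\<lambda>(i, j). fst (T i j)) (SIGMA i:{1..l}. {..<m i}) \<and>
     (let B = attach_below (ribbon l S z) l z m T in
        P = B \<or>
        (\<exists>k\<in>{1..l}. \<exists>Q. \<exists>q\<in>fst Q. rooted_tree_poset Q \<and> fst Q \<inter> fst B = {} \<and>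
           P = attach_above B (z k) Q q)))"

definition remove_covers :: "'a poset \<Rightarrow> 'a rel \<Rightarrow> 'a poset"  (infixl \<open>\<ominus>\<close> 65) where
  "P \<ominus> F = generated_poset (fst P) (covers P - F)"

definition fold_poset :: "'a poset \<Rightarrow> 'a rel \<Rightarrow> 'a poset" where
  "fold_poset P F = generated_poset (fst P) (snd (P \<ominus> F) \<union> F\<inverse>)"

text \<open>Parallel edges are identified here. There are none when \<open>P\<close> is a tree poset and
  \<^term>\<open>F \<subseteq> covers P\<close>: two of them would close a cycle in the Hasse diagram of \<open>P\<close>.\<close>

definition component_tree :: "'a poset \<Rightarrow> 'a rel \<Rightarrow> 'a set ugraph" where
  "component_tree P F =
     (graph_components (hasse (P \<ominus> F)),
      {{component_of (hasse (P \<ominus> F)) x, component_of (hasse (P \<ominus> F)) y} | x y. (x, y) \<in> F})"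

end

theory Submission
  imports Defs
begin

text \<open>Orient the Hasse tree of \<open>P\<close> upwards and let \<open>E\<close> be the underlying undirected tree. Reversing the edges
  in \<open>F\<close> gives the Hasse diagram of the fold, so the fold is rooted with root \<open>r\<close> iff all its edges
  point towards \<open>r\<close>. Moreover the component tree is a path iff \<open>F\<close> is contained in the edge set of a
  simple path of \<open>E\<close>: a path from the first to the last component must use every edge of \<open>F\<close>, and
  conversely the components are met one after the other along a simple path containing \<open>F\<close>.
  Hence the right-hand side says that for some simple path \<open>Z\<close> and some vertex \<open>r\<close> all edges
  off \<open>Z\<close> point towards \<open>r\<close>. Then \<open>Z\<close> is the ribbon, the branches off \<open>Z\<close> that do not contain \<open>r\<close> are
  rooted trees attached below \<open>Z\<close>, and the branch containing \<open>r\<close>, if there is one, is the tree \<open>Q\<close>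
  attached above.\<close>

section \<open>Walks and bridges\<close>

text \<open>A walk is a vertex list and its steps form a relation directed along the list, so
  \<open>steps vs \<subseteq> E\<close> says that \<open>vs\<close> is a walk in
  \<open>E\<close>.\<close>

fun steps :: "'a list \<Rightarrow> 'a rel" where
  "steps (x # y # zs) = insert (x, y) (steps (y # zs))"
| "steps _ = {}"

lemma steps_conv_zip: "steps vs = set (zip vs (tl vs))"
  by (induction vs rule: steps.induct) auto

lemma steps_conv_nth: "steps vs = {(vs ! i, vs ! Suc i) | i. Suc i < length vs}"
  by (fastforce simp: steps_conv_zip set_zip nth_tl)

lemma steps_subset_set: "steps vs \<subseteq> set vs \<times> set vs"
  by (induction vs rule: steps.induct) auto

lemma steps_append_Cons: "steps (xs @ y # ys) = steps (xs @ [y]) \<union> steps (y # ys)"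
  by (induction xs rule: steps.induct) auto

lemma steps_rtrancl:
  assumes "steps vs \<subseteq> E" "u \<in> set vs"
  shows "(hd vs, u) \<in> E\<^sup>*"
  using assms
  by (induction vs rule: steps.induct) (auto intro: converse_rtrancl_into_rtrancl)

lemma last_rtrancl:
  assumes "steps vs \<subseteq> E" "vs \<noteq> []"
  shows "(hd vs, last vs) \<in> E\<^sup>*"
  using assms by (intro steps_rtrancl) auto

text \<open>The path is built from its end by prepending vertices; if the new vertex
  \<open>u\<close> already occurs, the list is cut back to the suffix starting at that
  occurrence.\<close>

lemma rtrancl_imp_simple_path:
  assumes "(a, b) \<in> E\<^sup>*"
  obtains vs where "vs \<noteq> []" "hd vs = a" "last vs = b" "distinct vs" "steps vs \<subseteq> E"
proof -
  from assms have "\<exists>vs. vs \<noteq> [] \<and> hd vs = a \<and> last vs = b \<and> distinct vs \<and> steps vs \<subseteq> E"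
  proof (induction rule: converse_rtrancl_induct)
    case base
    show ?case by (rule exI[of _ "[b]"]) auto
  next
    case (step u a)
    then obtain vs where vs: "vs \<noteq> []" "hd vs = a" "last vs = b" "distinct vs" "steps vs \<subseteq> E"
      by blast
    show ?case
    proof (cases "u \<in> set vs")
      case True
      then obtain ys zs where "vs = ys @ u # zs" by (meson split_list)
      with vs show ?thesis
        using steps_append_Cons[of ys u zs]
        by (intro exI[of _ "u # zs"]) auto
    next
      case False
      with vs step show ?thesis
        by (intro exI[of _ "u # vs"]) (cases vs; auto)
    qed
  qed
  with that show thesis by blast
qed

text \<open>Acyclicity of a symmetric relation \<open>E\<close>: every edge separates its ends. Loops are excluded,
  because the relation \<open>rtrancl\<close> is reflexive.\<close>

definition bridges :: "'a rel \<Rightarrow> bool" where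
  "bridges E \<longleftrightarrow> (\<forall>x y. (x, y) \<in> E \<longrightarrow> (x, y) \<notin> (E - {(x, y), (y, x)})\<^sup>*)"

lemma bridgesD: "bridges E \<Longrightarrow> (x, y) \<in> E \<Longrightarrow> (x, y) \<notin> (E - {(x, y), (y, x)})\<^sup>*"
  by (simp add: bridges_def)

lemma bridges_mono:
  assumes "bridges E" "E' \<subseteq> E"
  shows "bridges E'"
  unfolding bridges_def
proof (intro allI impI)
  fix x y assume "(x, y) \<in> E'"
  moreover have "(E' - {(x, y), (y, x)})\<^sup>* \<subseteq> (E - {(x, y), (y, x)})\<^sup>*"
    using assms(2) by (intro rtrancl_mono) blast
  ultimately show "(x, y) \<notin> (E' - {(x, y), (y, x)})\<^sup>*"
    using bridgesD[OF assms(1), of x y] assms(2) by (meson subsetD)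
qed

lemma sym_rtrancl_sym: "sym E \<Longrightarrow> (x, y) \<in> E\<^sup>* \<Longrightarrow> (y, x) \<in> E\<^sup>*"
  by (meson sym_rtrancl symD)

lemma sym_rtrancl_minus_edge:
  assumes "sym E" "(u, v) \<in> (E - {(x, y), (y, x)})\<^sup>*"
  shows "(v, u) \<in> (E - {(x, y), (y, x)})\<^sup>*"
proof -
  have "sym (E - {(x, y), (y, x)})" using assms(1) by (auto simp: sym_def)
  then show ?thesis using assms(2) by (rule sym_rtrancl_sym)
qed

lemma steps_avoid:
  assumes "x \<notin> set vs" shows "steps vs \<inter> {(x, y), (y, x)} = {}"
  using steps_subset_set[of vs] assms by auto

lemma is_cycle_steps:
  "is_cycle G vs \<longleftrightarrow> 3 \<le> length vs \<and> distinct vs \<and> steps vs \<subseteq> adj_rel G \<and> (last vs, hd vs) \<in> adj_rel G"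
  by (auto simp: is_cycle_def steps_conv_nth)

lemma sym_adj_rel: "sym (adj_rel G)"
  by (auto simp: sym_def adj_rel_def insert_commute)

text \<open>A detour around an edge can be taken to be a simple path, which the edge closes to a
  cycle; conversely the rest of a cycle is a detour around any one of its edges. Irreflexivity
  excludes loops, which violate \<open>bridges\<close> but are invisible to
  \<open>is_cycle\<close>.\<close>

lemma no_cycle_iff_bridges:
  assumes "irrefl (adj_rel G)"
  shows "(\<nexists>vs. is_cycle G vs) \<longleftrightarrow> bridges (adj_rel G)"
proof
  let ?E = "adj_rel G"
  assume no: "\<nexists>vs. is_cycle G vs"
  show "bridges ?E"
    unfolding bridges_def
  proof (intro allI impI notI)
    fix x y assume xy: "(x, y) \<in> ?E" and "(x, y) \<in> (?E - {(x, y), (y, x)})\<^sup>*"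
    then obtain vs where vs: "vs \<noteq> []" "hd vs = x" "last vs = y" "distinct vs"
      "steps vs \<subseteq> ?E - {(x, y), (y, x)}"
      by (elim rtrancl_imp_simple_path)
    have "x \<noteq> y" using xy assms by (auto simp: irrefl_def)
    obtain u v ws where "vs = u # v # ws"
      using vs \<open>x \<noteq> y\<close> by (cases vs rule: steps.cases) auto
    \<comment> \<open>A path with only two vertices would be the removed edge itself.\<close>
    with vs have "3 \<le> length vs" by (cases ws) auto
    moreover have "(y, x) \<in> ?E" using xy sym_adj_rel[of G] by (auto dest: symD)
    ultimately have "is_cycle G vs" using vs by (auto simp: is_cycle_steps)
    with no show False by blast
  qed
next
  let ?E = "adj_rel G"
  assume br: "bridges ?E"
  show "\<nexists>vs. is_cycle G vs"
  proof
    assume "\<exists>vs. is_cycle G vs"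
    then obtain vs where vs: "3 \<le> length vs" "distinct vs" "steps vs \<subseteq> ?E" "(last vs, hd vs) \<in> ?E"
      by (auto simp: is_cycle_steps)
    then obtain u v w ws where eq: "vs = u # v # w # ws"
      by (metis Suc_le_length_iff numeral_3_eq_3)
    let ?y = "last vs"
    have uv: "(u, v) \<in> ?E" using vs eq by auto
    have y: "?y = last (w # ws)" "?y \<in> set (w # ws)" using eq by auto
    have "(v, ?y) \<in> (?E - {(u, v), (v, u)})\<^sup>*"
    proof -
      have "steps (v # w # ws) \<subseteq> ?E - {(u, v), (v, u)}"
        using vs eq steps_avoid[of u "v # w # ws" v] by auto
      from last_rtrancl[OF this] show ?thesis using eq by simp
    qed
    moreover have "(?y, u) \<in> ?E - {(u, v), (v, u)}"
      using vs eq y by (auto simp: irrefl_def)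
    ultimately have "(v, u) \<in> (?E - {(u, v), (v, u)})\<^sup>*" by (rule rtrancl_into_rtrancl)
    then have "(u, v) \<in> (?E - {(u, v), (v, u)})\<^sup>*"
      using sym_adj_rel by (rule sym_rtrancl_minus_edge[rotated])
    with br uv show False by (auto dest: bridgesD)
  qed
qed

section \<open>Posets generated by oriented trees\<close>

text \<open>Asymmetry is demanded separately because \<open>bridges\<close> sees only undirected
  edges: a pair of opposite arrows counts there as a single edge.\<close>

definition oriented_forest :: "'a rel \<Rightarrow> bool" where
  "oriented_forest R \<longleftrightarrow> R \<inter> R\<inverse> = {} \<and> bridges (R \<union> R\<inverse>)"

lemma oriented_forest_mono:
  "oriented_forest R \<Longrightarrow> R' \<subseteq> R \<Longrightarrow> oriented_forest R'"
  unfolding oriented_forest_def by (blast intro: bridges_mono)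

text \<open>The walk is stopped at its first visit to \<open>x\<close>.\<close>

lemma rtrancl_avoid_target:
  assumes "(y, x) \<in> R\<^sup>*"
  shows "(y, x) \<in> (R - {x} \<times> UNIV)\<^sup>*"
  using assms
proof (induction rule: converse_rtrancl_induct)
  case (step u v)
  then show ?case by (cases "u = x") (auto intro: converse_rtrancl_into_rtrancl)
qed auto

text \<open>A directed cycle through an edge from \<open>x\<close> to \<open>y\<close> contains a
  way back from \<open>y\<close> that stops on reaching \<open>x\<close>. It uses neither this edge
  nor, by asymmetry, its reverse, so the edge would not be a bridge.\<close>

lemma oriented_forest_acyclic:
  assumes "oriented_forest R"
  shows "acyclic R"
  unfolding acyclic_def
proof (intro allI notI)
  fix x assume "(x, x) \<in> R\<^sup>+"
  then obtain y where xy: "(x, y) \<in> R" and "(y, x) \<in> R\<^sup>*" by (meson tranclD)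
  from this(2) have "(y, x) \<in> (R - {x} \<times> UNIV)\<^sup>*" by (rule rtrancl_avoid_target)
  moreover have "R - {x} \<times> UNIV \<subseteq> R \<union> R\<inverse> - {(y, x), (x, y)}"
    using assms xy by (auto simp: oriented_forest_def)
  ultimately have "(y, x) \<in> (R \<union> R\<inverse> - {(y, x), (x, y)})\<^sup>*"
    by (meson rtrancl_mono subsetD)
  with xy assms show False
    by (auto simp: oriented_forest_def dest: bridgesD)
qed

lemma acyclic_rtrancl_trancl: "acyclic R \<Longrightarrow> (x, y) \<in> R\<^sup>* \<Longrightarrow> (y, x) \<in> R\<^sup>+ \<Longrightarrow> False"
  by (meson acyclic_def rtrancl_trancl_trancl)

text \<open>No edge of an oriented forest is implied by the others: a chain from \<open>x\<close> to
  \<open>y\<close> through a third element would bypass the edge. Hence the generators are already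
  the Hasse diagram.\<close>

lemma covers_generated_poset:
  assumes of: "oriented_forest R" and sub: "R \<subseteq> A \<times> A"
  shows "covers (generated_poset A R) = R"
proof -
  have ac: "acyclic R" using of by (rule oriented_forest_acyclic)
  have "(x, y) \<in> covers (generated_poset A R) \<longleftrightarrow> (x, y) \<in> R" for x y
  proof
    assume "(x, y) \<in> covers (generated_poset A R)"
    then have xy: "(x, y) \<in> R\<^sup>+" and x: "x \<noteq> y"
      and no: "\<And>w. w \<noteq> x \<Longrightarrow> w \<noteq> y \<Longrightarrow> (x, w) \<in> R\<^sup>+ \<Longrightarrow> (w, y) \<notin> R\<^sup>+"
      by (auto simp: covers_def generated_poset_def)
    from xy obtain w where w: "(x, w) \<in> R" "(w, y) \<in> R\<^sup>*" by (meson tranclD)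
    have "w \<noteq> x" using w ac by (auto simp: acyclic_def)
    with no[of w] w show "(x, y) \<in> R"
      by (metis r_into_trancl rtranclD)
  next
    assume xy: "(x, y) \<in> R"
    have "x \<noteq> y" using xy ac by (auto simp: acyclic_def)
    moreover have False if w: "w \<noteq> x" "w \<noteq> y" "(x, w) \<in> R\<^sup>+" "(w, y) \<in> R\<^sup>+" for w
    proof -
      let ?E = "R \<union> R\<inverse> - {(x, y), (y, x)}"
      have yx: "(y, x) \<notin> R" using xy of by (auto simp: oriented_forest_def)
      \<comment> \<open>The chain through \<open>w\<close> avoids the edge: by acyclicity its lower
        half never enters \<open>y\<close> and its upper half uses no step out of
        \<open>x\<close>.\<close>
      have "(x, w) \<in> (R - UNIV \<times> {y})\<^sup>*"
        using trancl_into_rtrancl[OF w(3)]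
      proof (induction rule: converse_rtrancl_induct)
        case (step u v)
        then have "v \<noteq> y" using acyclic_rtrancl_trancl[OF ac] w(4) by blast
        with step show ?case by (auto intro: converse_rtrancl_into_rtrancl)
      qed auto
      moreover have "(w, y) \<in> (R - {x} \<times> UNIV)\<^sup>*"
        using trancl_into_rtrancl[OF w(4)]
      proof (induction rule: rtrancl_induct)
        case (step u v)
        then have "u \<noteq> x" using acyclic_rtrancl_trancl[OF ac] w(3) by blast
        with step show ?case by (auto intro: rtrancl_into_rtrancl)
      qed auto
      moreover have "R - UNIV \<times> {y} \<subseteq> ?E" "R - {x} \<times> UNIV \<subseteq> ?E"
        using yx by auto
      ultimately have "(x, w) \<in> ?E\<^sup>*" "(w, y) \<in> ?E\<^sup>*"
        by (meson rtrancl_mono subsetD)+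
      then have "(x, y) \<in> ?E\<^sup>*" by (rule rtrancl_trans)
      with of xy show False by (auto simp: oriented_forest_def dest: bridgesD)
    qed
    ultimately show "(x, y) \<in> covers (generated_poset A R)"
      using xy sub by (auto simp: covers_def generated_poset_def)
  qed
  then show ?thesis by auto
qed

lemma finite_poset_generated:
  assumes "finite A" "R \<subseteq> A \<times> A" "acyclic R"
  shows "finite_poset (generated_poset A R)"
proof -
  have sub: "R\<^sup>+ \<subseteq> A \<times> A" using assms(2) by (rule trancl_subset_Sigma)
  have "trans (Id_on A \<union> R\<^sup>+)"
    by (auto simp: trans_def intro: trancl_trans)
  moreover have "antisym (Id_on A \<union> R\<^sup>+)"
    using assms(3) by (auto simp: antisym_def acyclic_def dest: trancl_trans)
  ultimately show ?thesis
    using assms(1) sub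
    by (auto simp: finite_poset_def generated_poset_def partial_order_on_def preorder_on_def refl_on_def)
qed

lemma finite_posetD:
  assumes "finite_poset P"
  shows "finite (fst P)" "snd P \<subseteq> fst P \<times> fst P" "trans (snd P)" "antisym (snd P)"
    "x \<in> fst P \<Longrightarrow> (x, x) \<in> snd P"
  using assms
  by (auto simp: finite_poset_def partial_order_on_def preorder_on_def refl_on_def)

lemma covers_subset: "finite_poset P \<Longrightarrow> covers P \<subseteq> fst P \<times> fst P"
  using finite_posetD(2)[of P] by (auto simp: covers_def)

lemma covers_antisym: "finite_poset P \<Longrightarrow> covers P \<inter> (covers P)\<inverse> = {}"
  using finite_posetD(4)[of P] by (auto simp: covers_def antisym_def)

text \<open>Induction on the size of the interval between \<open>x\<close> and \<open>y\<close>: if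
  the pair is not a cover, an element \<open>w\<close> strictly between them splits it into two
  intervals with fewer elements.\<close>

lemma generated_poset_covers:
  assumes P: "finite_poset P"
  shows "generated_poset (fst P) (covers P) = P"
proof -
  note D = finite_posetD[OF P]
  have "(x, y) \<in> (covers P)\<^sup>+" if "(x, y) \<in> snd P" "x \<noteq> y" for x y
    using that
  proof (induction "card {w. (x, w) \<in> snd P \<and> (w, y) \<in> snd P}" arbitrary: x y rule: less_induct)
    case less
    let ?I = "\<lambda>x y. {w. (x, w) \<in> snd P \<and> (w, y) \<in> snd P}"
    have fin: "finite (?I x y)" for x y
      using D(1,2) by (auto intro: finite_subset[of _ "fst P"])
    show ?case
    proof (cases "(x, y) \<in> covers P")
      case False
      then obtain w where w: "w \<noteq> x" "w \<noteq> y" "(x, w) \<in> snd P" "(w, y) \<in> snd P"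
        using less.prems by (auto simp: covers_def)
      have "?I x w \<subset> ?I x y" "?I w y \<subset> ?I x y"
        using w D(2,5) less.prems transD[OF D(3)] antisymD[OF D(4)] by blast+
      then have "card (?I x w) < card (?I x y)" "card (?I w y) < card (?I x y)"
        by (auto intro: psubset_card_mono[OF fin])
      with less.hyps w show ?thesis by (blast intro: trancl_trans)
    qed auto
  qed
  moreover have "(covers P)\<^sup>+ \<subseteq> snd P"
  proof -
    have "(covers P)\<^sup>+ \<subseteq> (snd P)\<^sup>+" by (rule trancl_mono_subset) (auto simp: covers_def)
    also have "\<dots> = snd P" using D(3) by (rule trancl_id)
    finally show ?thesis .
  qed
  ultimately have "Id_on (fst P) \<union> (covers P)\<^sup>+ = snd P"
    using D(2,5) by auto
  then show ?thesis by (simp add: generated_poset_def)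
qed

lemma adj_rel_hasse:
  "covers P \<subseteq> fst P \<times> fst P \<Longrightarrow> adj_rel (hasse P) = covers P \<union> (covers P)\<inverse>"
  by (auto simp: adj_rel_def hasse_def doubleton_eq_iff)

text \<open>The working form of a tree poset, with \<open>R\<close> as its Hasse diagram.
  \<open>tree_poset_imp_oriented_tree\<close> and \<open>oriented_tree_generates_tree_poset\<close>
  translate in both directions, so that folding and attaching become operations on edges.\<close>

definition oriented_tree :: "'a set \<Rightarrow> 'a rel \<Rightarrow> bool" where
  "oriented_tree A R \<longleftrightarrow> finite A \<and> A \<noteq> {} \<and> R \<subseteq> A \<times> A \<and> oriented_forest R \<and>
     (\<forall>u\<in>A. \<forall>v\<in>A. (u, v) \<in> (R \<union> R\<inverse>)\<^sup>*)"

lemma tree_poset_imp_oriented_tree: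
  assumes "tree_poset P"
  shows "oriented_tree (fst P) (covers P)"
proof -
  have P: "finite_poset P" using assms by (simp add: tree_poset_def)
  have adj: "adj_rel (hasse P) = covers P \<union> (covers P)\<inverse>"
    using P by (intro adj_rel_hasse covers_subset)
  have "irrefl (adj_rel (hasse P))"
    unfolding adj by (auto simp: irrefl_def covers_def)
  from no_cycle_iff_bridges[OF this] show ?thesis
    using assms P covers_subset[OF P] covers_antisym[OF P] finite_posetD(1)[OF P]
    by (auto simp: tree_poset_def tree_graph_def connected_graph_def oriented_tree_def
        oriented_forest_def adj) (auto simp: hasse_def)
qed

lemma oriented_tree_generates_tree_poset:
  assumes "oriented_tree A R"
  shows "tree_poset (generated_poset A R)"
proof -
  let ?P = "generated_poset A R"
  have R: "finite A" "R \<subseteq> A \<times> A" "oriented_forest R"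
    using assms by (auto simp: oriented_tree_def)
  have P: "finite_poset ?P" using R by (intro finite_poset_generated oriented_forest_acyclic)
  have c: "covers ?P = R" using R by (intro covers_generated_poset)
  have fst: "fst ?P = A" by (simp add: generated_poset_def)
  have adj: "adj_rel (hasse ?P) = R \<union> R\<inverse>"
    using adj_rel_hasse[of ?P] c fst R by simp
  have "irrefl (adj_rel (hasse ?P))"
    using R(3) by (auto simp: adj irrefl_def oriented_forest_def)
  from no_cycle_iff_bridges[OF this] show ?thesis
    using assms P fst
    by (auto simp: tree_poset_def tree_graph_def connected_graph_def oriented_tree_def
        oriented_forest_def adj) (auto simp: hasse_def)
qed

section \<open>Rooted trees\<close>

text \<open>A rooted tree given by its parent function: \<open>R\<close> sends each vertex other
  than \<open>r\<close> to its parent, and iterating leads to \<open>r\<close>. Acyclicity and the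
  tree property are derived from this.\<close>

definition rooted :: "'a set \<Rightarrow> 'a rel \<Rightarrow> 'a \<Rightarrow> bool" where
  "rooted A R r \<longleftrightarrow> finite A \<and> R \<subseteq> A \<times> A \<and> r \<in> A \<and> single_valued R \<and> r \<notin> Domain R \<and>
     (\<forall>x\<in>A. (x, r) \<in> R\<^sup>*)"

lemma rootedI:
  assumes "finite A" "R \<subseteq> A \<times> A" "r \<in> A" "single_valued R" "r \<notin> Domain R"
    "\<And>x. x \<in> A \<Longrightarrow> (x, r) \<in> R\<^sup>*"
  shows "rooted A R r"
  using assms by (simp add: rooted_def)

text \<open>A cycle through \<open>x\<close> is carried along the unique way from \<open>x\<close>
  up to \<open>r\<close>, so that \<open>r\<close> would have an outgoing edge.\<close>

lemma rooted_acyclic: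
  assumes "rooted A R r"
  shows "acyclic R"
  unfolding acyclic_def
proof (intro allI notI)
  fix x assume x: "(x, x) \<in> R\<^sup>+"
  have "x \<in> A" using x assms by (auto simp: rooted_def dest!: tranclD)
  then have "(x, r) \<in> R\<^sup>*" using assms by (auto simp: rooted_def)
  then have "(r, x) \<in> R\<^sup>+"
  proof (induction rule: rtrancl_induct)
    case (step u v)
    then obtain w where "(u, w) \<in> R" "(w, x) \<in> R\<^sup>*" by (meson tranclD)
    with step have "(v, x) \<in> R\<^sup>*" using assms by (auto simp: rooted_def dest: single_valuedD)
    then show ?case using x by (rule rtrancl_trancl_trancl)
  qed (rule x)
  then show False using assms by (auto simp: rooted_def dest!: tranclD)
qed

text \<open>Since a vertex has at most one parent, the edge from \<open>c\<close> to its parent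
  \<open>p\<close> is the only undirected edge that leaves the set of vertices below
  \<open>c\<close>.\<close>

lemma downset_closed:
  assumes "single_valued R" "(c, p) \<in> R" "(u, v) \<in> R \<union> R\<inverse> - {(c, p), (p, c)}" "(u, c) \<in> R\<^sup>*"
  shows "(v, c) \<in> R\<^sup>*"
proof (cases "(u, v) \<in> R")
  case True
  then have "u \<noteq> c" using assms by (auto dest: single_valuedD)
  with assms(4) obtain w where "(u, w) \<in> R" "(w, c) \<in> R\<^sup>*" by (meson converse_rtranclE)
  with True assms(1) show ?thesis by (auto dest: single_valuedD)
next
  case False
  with assms show ?thesis by (auto intro: converse_rtrancl_into_rtrancl)
qed

lemma downset_closed_rtrancl:
  assumes "single_valued R" "(c, p) \<in> R" "(u, v) \<in> (R \<union> R\<inverse> - {(c, p), (p, c)})\<^sup>*" "(u, c) \<in> R\<^sup>*"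
  shows "(v, c) \<in> R\<^sup>*"
  using assms(3,4) by (induction rule: rtrancl_induct) (auto intro: downset_closed[OF assms(1,2)])

text \<open>Deleting the edge from a vertex to its parent confines every walk from the vertex to its
  downset, and by acyclicity the parent is not in it. Connectedness goes through the root.\<close>

lemma rooted_imp_oriented_tree:
  assumes "rooted A R r"
  shows "oriented_tree A R"
proof -
  have ac: "acyclic R" using assms by (rule rooted_acyclic)
  have sv: "single_valued R" using assms by (auto simp: rooted_def)
  have as: "R \<inter> R\<inverse> = {}"
    using ac by (auto simp: acyclic_def) (meson r_into_trancl trancl_into_trancl)
  have key: "(x, y) \<notin> (R \<union> R\<inverse> - {(x, y), (y, x)})\<^sup>*" if "(x, y) \<in> R" for x y
    using downset_closed_rtrancl[OF sv that, of x y] that acyclic_rtrancl_trancl[OF ac, of y x] by auto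
  have "bridges (R \<union> R\<inverse>)"
    unfolding bridges_def
  proof (intro allI impI notI)
    fix x y assume xy: "(x, y) \<in> R \<union> R\<inverse>" "(x, y) \<in> (R \<union> R\<inverse> - {(x, y), (y, x)})\<^sup>*"
    have "sym (R \<union> R\<inverse>)" by (auto simp: sym_def)
    then have "(y, x) \<in> (R \<union> R\<inverse> - {(y, x), (x, y)})\<^sup>*"
      unfolding insert_commute[of "(y, x)"] using xy(2) by (rule sym_rtrancl_minus_edge)
    with xy key[of x y] key[of y x] show False by auto
  qed
  moreover have "(u, v) \<in> (R \<union> R\<inverse>)\<^sup>*" if "u \<in> A" "v \<in> A" for u v
  proof -
    have "(u, r) \<in> (R \<union> R\<inverse>)\<^sup>*" "(v, r) \<in> (R \<union> R\<inverse>)\<^sup>*"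
      using that assms rtrancl_mono[of R "R \<union> R\<inverse>"] by (auto simp: rooted_def)
    moreover have "sym (R \<union> R\<inverse>)" by (auto simp: sym_def)
    ultimately show ?thesis by (meson rtrancl_trans sym_rtrancl_sym)
  qed
  ultimately show ?thesis
    using assms as by (auto simp: oriented_tree_def oriented_forest_def rooted_def)
qed

lemma maximal_in_generated_poset:
  assumes "acyclic R" "R \<subseteq> A \<times> A"
  shows "maximal_in (generated_poset A R) x \<longleftrightarrow> x \<in> A \<and> x \<notin> Domain R"
proof -
  have "x \<notin> Domain R" if "\<forall>y\<in>A. x = y \<or> (x, y) \<in> R\<^sup>+ \<longrightarrow> y = x"
  proof
    assume "x \<in> Domain R"
    then obtain y where "(x, y) \<in> R" by blast
    with that assms show False by (auto simp: acyclic_def)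
  qed
  moreover have "(x, y) \<notin> R\<^sup>+" if "x \<notin> Domain R" for y
    using that by (auto dest: tranclD)
  ultimately show ?thesis
    by (auto simp: maximal_in_def generated_poset_def)
qed

lemma maximal_in_generated_poset_rooted:
  assumes "rooted A R r"
  shows "maximal_in (generated_poset A R) x \<longleftrightarrow> x = r"
proof -
  have "x = r" if "x \<in> A" "x \<notin> Domain R"
    using that assms unfolding rooted_def by (meson Domain.DomainI converse_rtranclE)
  then show ?thesis
    using assms maximal_in_generated_poset[OF rooted_acyclic[OF assms], of A x] by (auto simp: rooted_def)
qed

lemma rooted_generates_rooted_tree_poset:
  assumes "rooted A R r"
  shows "rooted_tree_poset (generated_poset A R)" "poset_root (generated_poset A R) = r"
  using maximal_in_generated_poset_rooted[OF assms]
    oriented_tree_generates_tree_poset[OF rooted_imp_oriented_tree[OF assms]]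
  by (auto simp: rooted_tree_poset_def poset_root_def)

text \<open>Going up from any vertex ends at a vertex without outgoing edge, which can only be
  \<open>r\<close>. If a vertex had two parents, the ways from both up to \<open>r\<close> would
  close a cycle.\<close>

lemma oriented_tree_unique_max_rooted:
  assumes ot: "oriented_tree A R" and r: "r \<in> A" "\<And>x. x \<in> A \<Longrightarrow> x \<notin> Domain R \<Longrightarrow> x = r"
    and "r \<notin> Domain R"
  shows "rooted A R r"
proof -
  have R: "finite A" "R \<subseteq> A \<times> A" and of: "oriented_forest R"
    using ot by (auto simp: oriented_tree_def)
  have ac: "acyclic R" using of by (rule oriented_forest_acyclic)
  have "finite R" using R by (meson finite_SigmaI finite_subset)
  then have "wf (R\<inverse>)" using ac by (rule finite_acyclic_wf_converse)
  then have reach: "x \<in> A \<longrightarrow> (x, r) \<in> R\<^sup>*" for x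
  proof (induction x rule: wf_induct_rule)
    case (less x)
    show ?case
    proof
      assume "x \<in> A"
      show "(x, r) \<in> R\<^sup>*"
      proof (cases "x \<in> Domain R")
        case True
        then obtain y where "(x, y) \<in> R" by auto
        with less[of y] R show ?thesis by (auto intro: converse_rtrancl_into_rtrancl)
      qed (use r \<open>x \<in> A\<close> in auto)
    qed
  qed
  have "single_valued R"
  proof (rule single_valuedI, rule ccontr)
    fix x y y' assume xy: "(x, y) \<in> R" "(x, y') \<in> R" "y \<noteq> y'"
    let ?E = "R \<union> R\<inverse> - {(x, y), (y, x)}"
    have sE: "sym ?E" by (auto simp: sym_def)
    \<comment> \<open>The way up from a vertex above \<open>x\<close> never returns to
      \<open>x\<close>, so it avoids the edge between \<open>x\<close> and \<open>y\<close>.\<close>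
    have up: "(v, r) \<in> ?E\<^sup>*" if "(x, v) \<in> R" for v
    proof -
      have "(v, r) \<in> R\<^sup>*" using reach that R by auto
      then show ?thesis
      proof (induction rule: rtrancl_induct)
        case (step a b)
        then have "(x, a) \<in> R\<^sup>+" using that by simp
        then have "a \<noteq> x" using ac by (auto simp: acyclic_def)
        moreover have "b \<noteq> x"
          using \<open>(x, a) \<in> R\<^sup>+\<close> \<open>(a, b) \<in> R\<close> ac by (auto simp: acyclic_def dest: trancl_into_trancl)
        ultimately have "(a, b) \<in> ?E" using step by auto
        with step show ?case by (meson rtrancl_into_rtrancl)
      qed auto
    qed
    have "(x, y') \<in> ?E"
      using xy ac by (auto simp: acyclic_def)
    with up[OF xy(1)] up[OF xy(2)] have "(x, y) \<in> ?E\<^sup>*"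
      by (meson sE rtrancl_trans sym_rtrancl_sym converse_rtrancl_into_rtrancl)
    with of xy(1) show False by (auto simp: oriented_forest_def dest: bridgesD)
  qed
  then show ?thesis using R r(1) assms(4) reach by (simp add: rooted_def)
qed

lemma rooted_tree_poset_imp_rooted:
  assumes "rooted_tree_poset P"
  shows "rooted (fst P) (covers P) (poset_root P)"
proof -
  have tp: "tree_poset P" using assms by (simp add: rooted_tree_poset_def)
  then have ot: "oriented_tree (fst P) (covers P)" by (rule tree_poset_imp_oriented_tree)
  then have ac: "acyclic (covers P)" and sub: "covers P \<subseteq> fst P \<times> fst P"
    by (auto simp: oriented_tree_def intro: oriented_forest_acyclic)
  have gen: "generated_poset (fst P) (covers P) = P"
    using tp by (auto simp: tree_poset_def intro: generated_poset_covers)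
  have max: "maximal_in P x \<longleftrightarrow> x \<in> fst P \<and> x \<notin> Domain (covers P)" for x
    using maximal_in_generated_poset[OF ac sub] by (simp add: gen)
  have ex1: "\<exists>!x. maximal_in P x" using assms by (simp add: rooted_tree_poset_def)
  then have "maximal_in P (poset_root P)" unfolding poset_root_def by (rule theI')
  with ex1 max ot show ?thesis by (intro oriented_tree_unique_max_rooted) blast+
qed

section \<open>Folds\<close>

text \<open>Pairs that already follow from \<open>X\<close> add nothing to the closure. This
  exchanges full orders for their covers as generators of folds and attachments.\<close>

lemma generated_poset_cong:
  assumes "X \<subseteq> Y" "Y \<subseteq> Id_on A \<union> X\<^sup>+"
  shows "generated_poset A X = generated_poset A Y"
proof -
  have "X\<^sup>+ \<subseteq> Y\<^sup>+" using assms(1) by (rule trancl_mono_subset)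
  moreover have "Y\<^sup>+ \<subseteq> Id_on A \<union> X\<^sup>+"
  proof (rule subrelI)
    fix x y assume "(x, y) \<in> Y\<^sup>+"
    then show "(x, y) \<in> Id_on A \<union> X\<^sup>+"
      using assms(2) by (induction rule: trancl_induct) (blast intro: trancl_trans)+
  qed
  ultimately show ?thesis by (auto simp: generated_poset_def)
qed

text \<open>Reversing edges does not change the underlying undirected graph, which carries
  connectedness and the bridge property.\<close>

lemma oriented_tree_fold:
  assumes "oriented_tree A R" "F \<subseteq> R"
  shows "oriented_tree A (R - F \<union> F\<inverse>)"
proof -
  have "(R - F \<union> F\<inverse>) \<union> (R - F \<union> F\<inverse>)\<inverse> = R \<union> R\<inverse>" using assms(2) by auto
  moreover have "R \<inter> R\<inverse> = {}" using assms by (simp add: oriented_tree_def oriented_forest_def)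
  then have "(R - F \<union> F\<inverse>) \<inter> (R - F \<union> F\<inverse>)\<inverse> = {}" using assms(2) by auto
  moreover have "R - F \<union> F\<inverse> \<subseteq> A \<times> A" using assms by (auto simp: oriented_tree_def)
  ultimately show ?thesis using assms by (simp add: oriented_tree_def oriented_forest_def)
qed

text \<open>The order of \<open>P \<ominus> F\<close> is replaced by its generating covers. For a
  tree poset \<open>P\<close> and a set \<open>F\<close> of covers, the relation on the right is
  then the Hasse diagram of the fold.\<close>

lemma fold_poset_conv:
  "fold_poset P F = generated_poset (fst P) (covers P - F \<union> F\<inverse>)"
proof -
  have "(covers P - F)\<^sup>+ \<subseteq> (covers P - F \<union> F\<inverse>)\<^sup>+" by (rule trancl_mono_subset) blast
  then have "generated_poset (fst P) (covers P - F \<union> F\<inverse>) =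
      generated_poset (fst P) (Id_on (fst P) \<union> (covers P - F)\<^sup>+ \<union> F\<inverse>)"
    by (intro generated_poset_cong) auto
  then show ?thesis by (simp add: fold_poset_def remove_covers_def generated_poset_def)
qed

lemma rooted_fold_iff:
  assumes "tree_poset P" "F \<subseteq> covers P"
  shows "rooted_tree_poset (fold_poset P F) \<longleftrightarrow> (\<exists>r. rooted (fst P) (covers P - F \<union> F\<inverse>) r)"
proof -
  let ?R = "covers P - F \<union> F\<inverse>"
  have ot: "oriented_tree (fst P) ?R"
    using assms by (intro oriented_tree_fold tree_poset_imp_oriented_tree)
  then have "covers (generated_poset (fst P) ?R) = ?R"
    by (intro covers_generated_poset) (auto simp: oriented_tree_def)
  then show ?thesis
    using rooted_tree_poset_imp_rooted[of "fold_poset P F"]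
      rooted_generates_rooted_tree_poset(1)[of "fst P" ?R]
    unfolding fold_poset_conv by (metis fst_conv generated_poset_def)
qed

section \<open>Component trees that are paths\<close>

lemma steps_map: "steps (map f vs) = map_prod f f ` steps vs"
  by (induction vs rule: steps.induct) auto

text \<open>Meant for the components met along a walk: staying in a component yields loops, and
  collapsing repetitions removes these and nothing else.\<close>

lemma steps_remdups_adj: "steps (remdups_adj vs) = steps vs - Id"
proof (induction vs rule: remdups_adj.induct)
  case (3 x y xs)
  show ?case
  proof (cases "x = y")
    case False
    have "remdups_adj (y # xs) = y # tl (remdups_adj (y # xs))" by simp
    then have "steps (x # remdups_adj (y # xs)) = insert (x, y) (steps (remdups_adj (y # xs)))"
      by (metis steps.simps(1))
    with False 3 show ?thesis by auto
  qed (use 3 in auto)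
qed auto

lemma path_graph_conv_steps:
  "path_graph G \<longleftrightarrow> (\<exists>vs. vs \<noteq> [] \<and> distinct vs \<and> fst G = set vs \<and>
     snd G = (\<lambda>(x, y). {x, y}) ` steps vs)"
proof -
  have "{{vs ! i, vs ! Suc i} | i. Suc i < length vs} = (\<lambda>(x, y). {x, y}) ` steps vs" for vs :: "'a list"
    by (auto simp: steps_conv_nth image_iff)
  then show ?thesis by (simp add: path_graph_def)
qed

text \<open>Turns the condition on the component tree into one on the edges of the Hasse tree:
  \<open>vs\<close> is a simple path through all edges of \<open>F\<close>. Such a path meets every
  component and returns to none; conversely a simple path between the two end components must use
  each edge of \<open>F\<close>.\<close>

lemma component_tree_path_iff:
  assumes tp: "tree_poset P" and F: "F \<subseteq> covers P"
  shows "path_graph (component_tree P F) \<longleftrightarrow>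
    (\<exists>vs. vs \<noteq> [] \<and> distinct vs \<and> set vs \<subseteq> fst P \<and> steps vs \<subseteq> covers P \<union> (covers P)\<inverse> \<and>
       F \<subseteq> steps vs \<union> (steps vs)\<inverse>)"
proof -
  define A where "A = fst P"
  define R where "R = covers P"
  define E where "E = R \<union> R\<inverse>"
  \<comment> \<open>\<open>N\<close> is the undirected graph left after deleting \<open>F\<close>;
    the classes \<open>c x\<close> of vertices joined in \<open>N\<close> are the vertices of the
    component tree.\<close>
  define N where "N = (R - F) \<union> (R - F)\<inverse>"
  define c where "c = component_of (hasse (P \<ominus> F))"
  have "oriented_tree A R"
    unfolding A_def R_def using tp by (rule tree_poset_imp_oriented_tree)
  then have A: "A \<noteq> {}" and RA: "R \<subseteq> A \<times> A" and of: "oriented_forest R"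
    and conn: "\<And>u v. u \<in> A \<Longrightarrow> v \<in> A \<Longrightarrow> (u, v) \<in> E\<^sup>*"
    by (auto simp: oriented_tree_def E_def)
  have br: "bridges E" and as: "R \<inter> R\<inverse> = {}"
    using of by (auto simp: oriented_forest_def E_def)
  have FR: "F \<subseteq> R" using F by (simp add: R_def)
  have EA: "E \<subseteq> A \<times> A" using RA by (auto simp: E_def)
  have symE: "sym E" and symN: "sym N" by (auto simp: E_def N_def sym_def)
  have NE: "N = E - (F \<union> F\<inverse>)"
    using as FR by (auto simp: N_def E_def)
  have FE: "F \<union> F\<inverse> \<subseteq> E" using FR by (auto simp: E_def)
  have sepN: "N \<subseteq> E - {(x, y), (y, x)}" if "(x, y) \<in> F \<union> F\<inverse>" for x y
    using that by (auto simp: NE)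
  have rm: "covers (P \<ominus> F) = R - F" "fst (P \<ominus> F) = A"
    using RA covers_generated_poset[OF oriented_forest_mono[OF of, of "R - F"], of A]
    by (auto simp: remove_covers_def R_def A_def generated_poset_def)
  have "adj_rel (hasse (P \<ominus> F)) = N"
    using adj_rel_hasse[of "P \<ominus> F"] RA by (auto simp: rm N_def)
  then have c: "c x = {v \<in> A. (x, v) \<in> N\<^sup>*}" for x
    by (simp add: c_def component_of_def rm hasse_def)
  have c_eq: "c x = c y \<longleftrightarrow> (x, y) \<in> N\<^sup>*" if "x \<in> A" "y \<in> A" for x y
  proof
    assume "c x = c y" with that show "(x, y) \<in> N\<^sup>*" by (auto simp: c)
  next
    assume "(x, y) \<in> N\<^sup>*"
    then show "c x = c y"
      using sym_rtrancl_sym[OF symN] by (auto simp: c intro: rtrancl_trans)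
  qed
  \<comment> \<open>\<open>N\<close> avoids the edges of \<open>F\<close>, and each of these
    separates its ends in the tree.\<close>
  have c_F: "c x \<noteq> c y" if "(x, y) \<in> F \<union> F\<inverse>" for x y
  proof
    assume "c x = c y"
    then have "(x, y) \<in> N\<^sup>*" using c_eq that FE EA by blast
    then have "(x, y) \<in> (E - {(x, y), (y, x)})\<^sup>*"
      using rtrancl_mono[OF sepN[OF that]] by blast
    then show False using bridgesD[OF br] that FE by blast
  qed
  have G: "component_tree P F = (c ` A, {{c x, c y} | x y. (x, y) \<in> F})"
    by (simp add: component_tree_def graph_components_def c_def hasse_def rm)

  \<comment> \<open>From a simple path through \<open>F\<close> to a path of components\<close>
  let ?Q = "\<lambda>vs. vs \<noteq> [] \<and> distinct vs \<and> set vs \<subseteq> A \<and> steps vs \<subseteq> E \<and> F \<subseteq> steps vs \<union> (steps vs)\<inverse>"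
  have "path_graph (component_tree P F)" if Q: "?Q vs" for vs
  proof -
    let ?cs = "remdups_adj (map c vs)"
    have "distinct (remdups_adj (map c ws))" if "steps ws \<subseteq> E" "distinct ws" "set ws \<subseteq> A" for ws
      using that
    proof (induction ws rule: steps.induct)
      case (1 x y zs)
      have xy: "(x, y) \<in> E" using 1 by simp
      show ?case
      proof (cases "c x = c y")
        case False
        then have xyF: "(x, y) \<in> F \<union> F\<inverse>" using xy c_eq 1 NE by auto
        \<comment> \<open>Once the walk leaves the component of \<open>x\<close> along an edge of
          \<open>F\<close> it cannot come back: the remaining steps avoid \<open>x\<close>, hence
          that edge, and a return would bypass a bridge.\<close>
        have "c x \<notin> c ` set (y # zs)"
        proof
          assume "c x \<in> c ` set (y # zs)"
          then obtain u where u: "u \<in> set (y # zs)" "c x = c u" by blast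
          have "(x, u) \<in> N\<^sup>*" using u c_eq 1 by auto
          then have "(x, u) \<in> (E - {(x, y), (y, x)})\<^sup>*"
            using rtrancl_mono[OF sepN[OF xyF]] by blast
          moreover have "steps (y # zs) \<subseteq> E - {(x, y), (y, x)}"
            using 1 steps_avoid[of x "y # zs" y] by auto
          then have "(y, u) \<in> (E - {(x, y), (y, x)})\<^sup>*"
            using steps_rtrancl[of "y # zs" _ u] u by auto
          ultimately have "(x, y) \<in> (E - {(x, y), (y, x)})\<^sup>*"
            by (meson rtrancl_trans sym_rtrancl_minus_edge symE)
          then show False using bridgesD[OF br xy] by blast
        qed
        with False 1 show ?thesis by auto
      qed (use 1 in auto)
    qed auto
    then have "distinct ?cs" using Q by blast
    moreover have "c ` A = set ?cs"
    proof -
      obtain v0 where v0: "v0 \<in> set vs" using Q by (cases vs) auto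
      \<comment> \<open>A walk in \<open>E\<close> from \<open>u\<close> to \<open>v0\<close> either
        stays in \<open>N\<close> or meets an edge of \<open>F\<close>, and the ends of that edge
        lie on \<open>vs\<close>.\<close>
      have "\<exists>v\<in>set vs. (u, v) \<in> N\<^sup>*" if "u \<in> A" for u
      proof -
        have "(u, v0) \<in> E\<^sup>*" using conn that v0 Q by auto
        then show ?thesis
        proof (induction rule: converse_rtrancl_induct)
          case (step u w)
          show ?case
          proof (cases "(u, w) \<in> N")
            case True
            with step show ?thesis by (meson converse_rtrancl_into_rtrancl)
          next
            case False
            then have "u \<in> set vs" using step NE Q steps_subset_set[of vs] by blast
            then show ?thesis by blast
          qed
        qed (use v0 in blast)
      qed
      then have "\<exists>v\<in>set vs. c u = c v" if "u \<in> A" for u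
        using that Q c_eq by (meson subsetD)
      then have "c ` A \<subseteq> c ` set vs" by auto
      then show ?thesis using Q by auto
    qed
    moreover have "{{c x, c y} | x y. (x, y) \<in> F} = (\<lambda>(x, y). {x, y}) ` steps ?cs" (is "?L = ?R")
    proof
      show "?L \<subseteq> ?R"
      proof
        fix e assume "e \<in> ?L"
        then obtain x y where xy: "(x, y) \<in> F" "e = {c x, c y}" by blast
        then have "c x \<noteq> c y" using c_F by blast
        moreover have "(x, y) \<in> steps vs \<or> (y, x) \<in> steps vs" using xy Q by blast
        ultimately have "(c x, c y) \<in> steps ?cs \<or> (c y, c x) \<in> steps ?cs"
          unfolding steps_remdups_adj steps_map by (auto intro: rev_image_eqI)
        then show "e \<in> ?R" using xy(2) by (auto intro: rev_image_eqI)
      qed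
      show "?R \<subseteq> ?L"
      proof
        fix e assume "e \<in> ?R"
        then obtain u v where uv: "(u, v) \<in> steps vs" "c u \<noteq> c v" "e = {c u, c v}"
          by (auto simp: steps_remdups_adj steps_map)
        then have "(u, v) \<in> E" using Q by blast
        moreover have "(u, v) \<notin> N" using uv c_eq EA \<open>(u, v) \<in> E\<close> by blast
        ultimately have "(u, v) \<in> F \<or> (v, u) \<in> F" using NE by blast
        then show "e \<in> ?L" using uv(3) by (auto simp: insert_commute)
      qed
    qed
    moreover have "?cs \<noteq> []" using Q by simp
    ultimately show ?thesis unfolding path_graph_conv_steps G fst_conv snd_conv by blast
  qed

  \<comment> \<open>From a path of components to a simple path through \<open>F\<close>\<close>
  moreover have "\<exists>vs. ?Q vs" if "path_graph (component_tree P F)"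
  proof -
    from that obtain cs where cs: "cs \<noteq> []" "distinct cs" "c ` A = set cs"
      "{{c x, c y} | x y. (x, y) \<in> F} = (\<lambda>(x, y). {x, y}) ` steps cs"
      unfolding path_graph_conv_steps G fst_conv snd_conv by (elim exE conjE)
    \<comment> \<open>\<open>ix u\<close> is the position in \<open>cs\<close> of the component of
      \<open>u\<close>.\<close>
    have "\<exists>ix. \<forall>u\<in>A. ix u < length cs \<and> cs ! ix u = c u"
      using cs(3) by (intro bchoice ballI) (metis imageI in_set_conv_nth)
    then obtain ix where ix: "\<And>u. u \<in> A \<Longrightarrow> ix u < length cs" "\<And>u. u \<in> A \<Longrightarrow> cs ! ix u = c u"
      by blast
    have ix_eq: "ix u = i" if "u \<in> A" "i < length cs" "c u = cs ! i" for u i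
      using that ix cs(2) by (metis nth_eq_iff_index_eq)
    have "hd cs \<in> c ` A" "last cs \<in> c ` A" using cs by auto
    then obtain a b where ab: "a \<in> A" "b \<in> A" "c a = hd cs" "c b = last cs" by auto
    have ix_a: "ix a = 0" and ix_b: "ix b = length cs - 1"
      using ab cs(1) by (auto intro!: ix_eq simp: hd_conv_nth last_conv_nth)
    \<comment> \<open>A simple path from the first component to the last is the candidate; each edge
      of \<open>F\<close> is shown to lie on it.\<close>
    from conn[OF ab(1,2)] obtain vs where
      vs: "vs \<noteq> []" "hd vs = a" "last vs = b" "distinct vs" "steps vs \<subseteq> E"
      by (rule rtrancl_imp_simple_path)
    have "(x, y) \<in> steps vs \<union> (steps vs)\<inverse>" if xyF: "(x, y) \<in> F" for x y
    proof (rule ccontr)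
      assume no: "(x, y) \<notin> steps vs \<union> (steps vs)\<inverse>"
      let ?E = "E - {(x, y), (y, x)}"
      have xyA: "x \<in> A" "y \<in> A" "(x, y) \<in> E" using xyF FE EA by blast+
      have "steps vs \<subseteq> ?E" using vs(5) no by auto
      then have path: "(a, b) \<in> ?E\<^sup>*" using last_rtrancl vs by metis
      have "{c x, c y} \<in> (\<lambda>(x, y). {x, y}) ` steps cs" using cs(4) xyF by blast
      then obtain i where i: "Suc i < length cs" "{c x, c y} = {cs ! i, cs ! Suc i}"
        unfolding steps_conv_nth by auto
      have N_sub: "(u, v) \<in> N\<^sup>* \<Longrightarrow> (u, v) \<in> ?E\<^sup>*" for u v
        using rtrancl_mono[OF sepN] xyF by blast
      \<comment> \<open>With the edge between \<open>x\<close> and \<open>y\<close> deleted, no edge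
        leads from positions up to \<open>i\<close> to later ones: edges of \<open>N\<close> keep
        the position, and the other edges of \<open>F\<close> join positions \<open>j\<close> and
        \<open>Suc j\<close> with \<open>j \<noteq> i\<close>.\<close>
      have closed: "ix v \<le> i" if uv: "(u, v) \<in> ?E" and u: "ix u \<le> i" for u v
      proof (cases "(u, v) \<in> N")
        case True
        then have "c u = c v" "u \<in> A" "v \<in> A" using c_eq EA NE by blast+
        then have "ix u = ix v" using ix by (intro ix_eq) auto
        then show ?thesis using u by simp
      next
        case False
        then have uvF: "(u, v) \<in> F \<union> F\<inverse>" and uvA: "u \<in> A" "v \<in> A" using uv NE EA by blast+
        then have "{c u, c v} \<in> (\<lambda>(x, y). {x, y}) ` steps cs"
          unfolding cs(4)[symmetric] by (auto simp: insert_commute)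
        then obtain j where j: "Suc j < length cs" "{c u, c v} = {cs ! j, cs ! Suc j}"
          unfolding steps_conv_nth by auto
        \<comment> \<open>A second edge of \<open>F\<close> between the same two components would,
          together with ways inside them, bypass the edge between \<open>x\<close> and
          \<open>y\<close>.\<close>
        have "j \<noteq> i"
        proof
          assume "j = i"
          with i j have "{c u, c v} = {c x, c y}" by simp
          then consider "c x = c u" "c v = c y" | "c x = c v" "c u = c y"
            by (auto simp: doubleton_eq_iff)
          then have "(x, y) \<in> ?E\<^sup>*"
          proof cases
            case 1
            then have "(x, u) \<in> ?E\<^sup>*" "(v, y) \<in> ?E\<^sup>*" using c_eq xyA uvA N_sub by blast+
            with uv show ?thesis by (meson converse_rtrancl_into_rtrancl rtrancl_trans)
          next
            case 2
            then have "(x, v) \<in> ?E\<^sup>*" "(u, y) \<in> ?E\<^sup>*" using c_eq xyA uvA N_sub by blast+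
            moreover have "(v, u) \<in> ?E" using uv symE by (auto dest: symD)
            ultimately show ?thesis by (meson converse_rtrancl_into_rtrancl rtrancl_trans)
          qed
          then show False using bridgesD[OF br xyA(3)] by blast
        qed
        moreover have "ix u = j \<and> ix v = Suc j \<or> ix u = Suc j \<and> ix v = j"
          using j uvA ix_eq[of u] ix_eq[of v] by (auto simp: doubleton_eq_iff)
        ultimately show ?thesis using u by auto
      qed
      from path have "ix b \<le> i"
        by (induction rule: rtrancl_induct) (use ix_a closed in auto)
      with ix_b i(1) show False by simp
    qed
    moreover have "set vs \<subseteq> A"
    proof
      fix v assume "v \<in> set vs"
      then have "(a, v) \<in> E\<^sup>*" using steps_rtrancl[OF vs(5)] vs(2) by blast
      then show "v \<in> A" using ab(1) EA by (induction rule: rtrancl_induct) auto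
    qed
    ultimately show ?thesis using vs by (intro exI[of _ vs]) auto
  qed
  ultimately show ?thesis unfolding A_def E_def R_def by blast
qed

section \<open>Mobile tree posets have a fold along the ribbon\<close>

text \<open>The tree with root \<open>s\<close> is hung below \<open>a\<close>: the new edge gives
  \<open>s\<close> its only parent and all other parents stay as they are, so \<open>r\<close>
  remains the root.\<close>

lemma rooted_glue:
  assumes A: "rooted A R r" and B: "rooted B S s" and dis: "A \<inter> B = {}" and a: "a \<in> A"
  shows "rooted (A \<union> B) (R \<union> S \<union> {(s, a)}) r"
proof -
  let ?W = "R \<union> S \<union> {(s, a)}"
  have D: "Domain R \<subseteq> A" "Domain S \<subseteq> B" "s \<in> B" "s \<notin> Domain S" "r \<in> A" "r \<notin> Domain R"
    using A B by (auto simp: rooted_def)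
  have sv: "single_valued ?W"
  proof (rule single_valuedI)
    fix x y y' assume xy: "(x, y) \<in> ?W" "(x, y') \<in> ?W"
    have sv: "single_valued R" "single_valued S" using A B by (auto simp: rooted_def)
    consider "x \<in> A" | "x \<in> B" "x \<noteq> s" | "x = s" using xy D by blast
    then show "y = y'"
    proof cases
      case 1
      then have "(x, y) \<in> R" "(x, y') \<in> R" using xy D dis by blast+
      with sv show ?thesis by (auto dest: single_valuedD)
    next
      case 2
      then have "(x, y) \<in> S" "(x, y') \<in> S" using xy D dis by blast+
      with sv show ?thesis by (auto dest: single_valuedD)
    next
      case 3
      then have "y = a" "y' = a" using xy D dis by blast+
      then show ?thesis by simp
    qed
  qed
  have RW: "R\<^sup>* \<subseteq> ?W\<^sup>*" "S\<^sup>* \<subseteq> ?W\<^sup>*" by (auto intro!: rtrancl_mono)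
  have reachA: "(x, r) \<in> ?W\<^sup>*" if "x \<in> A" for x
    using A that RW by (auto simp: rooted_def)
  have reachB: "(x, r) \<in> ?W\<^sup>*" if "x \<in> B" for x
  proof -
    have "(x, s) \<in> ?W\<^sup>*" using B that RW by (auto simp: rooted_def)
    moreover have "(s, a) \<in> ?W" by simp
    ultimately show ?thesis using reachA[OF a] by (meson converse_rtrancl_into_rtrancl rtrancl_trans)
  qed
  show ?thesis
  proof (rule rootedI)
    show "finite (A \<union> B)" "?W \<subseteq> (A \<union> B) \<times> (A \<union> B)" using A B a by (auto simp: rooted_def)
    show "r \<in> A \<union> B" "r \<notin> Domain ?W" using D dis by auto
    show "(x, r) \<in> ?W\<^sup>*" if "x \<in> A \<union> B" for x using that reachA reachB by blast
  qed (rule sv)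
qed

lemma rooted_glue_family:
  assumes "finite I" "rooted A R r"
    and "\<And>i. i \<in> I \<Longrightarrow> rooted (B i) (S i) (s i)" "\<And>i. i \<in> I \<Longrightarrow> A \<inter> B i = {}"
    and "\<And>i. i \<in> I \<Longrightarrow> a i \<in> A" and "disjoint_family_on B I"
  shows "rooted (A \<union> (\<Union>i\<in>I. B i)) (R \<union> (\<Union>i\<in>I. S i \<union> {(s i, a i)})) r"
  using assms(1,3-)
proof (induction I rule: finite_induct)
  case (insert i I)
  let ?A = "A \<union> (\<Union>i\<in>I. B i)" and ?R = "R \<union> (\<Union>i\<in>I. S i \<union> {(s i, a i)})"
  have IH: "rooted ?A ?R r"
    using insert by (intro insert.IH) (auto simp: disjoint_family_on_def)
  have "B j \<inter> B i = {}" if "j \<in> I" for j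
    using insert.prems(4) insert.hyps(2) that by (auto simp: disjoint_family_on_def)
  then have dis: "?A \<inter> B i = {}" using insert.prems(2)[of i] by blast
  have "rooted (?A \<union> B i) (?R \<union> S i \<union> {(s i, a i)}) r"
    using insert.prems by (intro rooted_glue[OF IH _ dis]) auto
  moreover have "?A \<union> B i = A \<union> (\<Union>i\<in>insert i I. B i)" by auto
  moreover have "?R \<union> S i \<union> {(s i, a i)} = R \<union> (\<Union>i\<in>insert i I. S i \<union> {(s i, a i)})" by auto
  ultimately show ?case by simp
qed (use assms(2) in simp)

definition ribbon_covers :: "nat \<Rightarrow> nat set \<Rightarrow> (nat \<Rightarrow> 'a) \<Rightarrow> 'a rel" where
  "ribbon_covers l S z = {(z (Suc i), z i) | i. i \<in> S} \<union> {(z i, z (Suc i)) | i. i \<in> {1..l-1} - S}"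

lemma ribbon_conv: "ribbon l S z = generated_poset (z ` {1..l}) (ribbon_covers l S z)"
  by (simp add: ribbon_def ribbon_covers_def)

text \<open>The orientation that the fold is to give to the ribbon: both halves ascend to
  \<open>z k\<close>.\<close>

definition ribbon_towards :: "nat \<Rightarrow> nat \<Rightarrow> (nat \<Rightarrow> 'a) \<Rightarrow> 'a rel" where
  "ribbon_towards l k z = {(z i, z (Suc i)) | i. 1 \<le> i \<and> i < k} \<union> {(z (Suc i), z i) | i. k \<le> i \<and> i < l}"

lemma rooted_ribbon_towards:
  assumes "inj_on z {1..l}" "1 \<le> k" "k \<le> l"
  shows "rooted (z ` {1..l}) (ribbon_towards l k z) (z k)"
proof -
  let ?W = "ribbon_towards l k z"
  note inj = inj_on_eq_iff[OF assms(1)]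
  have up: "(z i, z k) \<in> ?W\<^sup>*" if "i \<le> k" "1 \<le> i" for i
    using that
  proof (induction rule: inc_induct)
    case (step n)
    then have "(z n, z (Suc n)) \<in> ?W" by (auto simp: ribbon_towards_def)
    with step show ?case by (auto intro: converse_rtrancl_into_rtrancl)
  qed auto
  have down: "(z i, z k) \<in> ?W\<^sup>*" if "k \<le> i" "i \<le> l" for i
    using that
  proof (induction rule: dec_induct)
    case (step n)
    then have "(z (Suc n), z n) \<in> ?W" by (auto simp: ribbon_towards_def)
    with step show ?case by (auto intro: converse_rtrancl_into_rtrancl)
  qed auto
  have "single_valued ?W"
  proof (rule single_valuedI)
    fix x y y' assume "(x, y) \<in> ?W" "(x, y') \<in> ?W"
    then show "y = y'"
      using assms(2,3) by (auto simp: ribbon_towards_def inj)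
  qed
  moreover have "z k \<notin> Domain ?W"
    using assms(2,3) by (auto simp: ribbon_towards_def inj)
  moreover have "?W \<subseteq> z ` {1..l} \<times> z ` {1..l}"
    using assms(2,3) by (auto simp: ribbon_towards_def)
  moreover have "(x, z k) \<in> ?W\<^sup>*" if "x \<in> z ` {1..l}" for x
    using that up down by (metis atLeastAtMost_iff imageE nle_le)
  ultimately show ?thesis using assms(2,3) by (auto simp: rooted_def)
qed

lemma steps_ribbon: "steps (map z [1..<Suc l]) = {(z i, z (Suc i)) | i. 1 \<le> i \<and> i < l}"
proof -
  have "steps [1..<Suc l] = {(i, Suc i) | i. 1 \<le> i \<and> i < l}" (is "?L = ?R")
  proof
    show "?L \<subseteq> ?R" by (auto simp: steps_conv_nth simp del: upt_Suc)
    show "?R \<subseteq> ?L"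
    proof
      fix p assume "p \<in> ?R"
      then obtain i where "p = (i, Suc i)" "1 \<le> i" "i < l" by blast
      \<comment> \<open>List positions start at 0 whereas the ribbon is numbered from 1, hence the
        witness \<open>i - 1\<close>.\<close>
      then show "p \<in> ?L"
        unfolding steps_conv_nth by (auto intro!: exI[of _ "i - 1"] simp del: upt_Suc)
    qed
  qed
  then show ?thesis by (auto simp: steps_map simp del: upt_Suc)
qed

text \<open>An edge of \<open>X\<close> outside \<open>W\<close> is directed oppositely in
  \<open>W\<close>, so reversing exactly these edges turns one orientation into the other.\<close>

lemma fold_diff:
  assumes "X \<union> X\<inverse> = W \<union> W\<inverse>" "X \<inter> X\<inverse> = {}" "W \<inter> W\<inverse> = {}"
  shows "X - (X - W) \<union> (X - W)\<inverse> = W"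
proof -
  have "(x, y) \<in> X \<or> (y, x) \<in> X \<longleftrightarrow> (x, y) \<in> W \<or> (y, x) \<in> W" for x y
    using assms(1) by (metis Un_iff converse_iff)
  moreover have "\<not> ((x, y) \<in> X \<and> (y, x) \<in> X)" "\<not> ((x, y) \<in> W \<and> (y, x) \<in> W)" for x y
    using assms(2,3) by blast+
  ultimately have "(x, y) \<in> X - (X - W) \<union> (X - W)\<inverse> \<longleftrightarrow> (x, y) \<in> W" for x y
    by (metis DiffD1 DiffD2 DiffI Un_iff converse_iff)
  then show ?thesis by auto
qed

text \<open>The common core of both cases of a mobile tree poset: \<open>Y\<close> collects all
  edges not on the ribbon, \<open>F\<close> will consist of the ribbon edges directed away from
  \<open>z k\<close>, and the simple path through \<open>F\<close> is the ribbon itself.\<close>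

lemma ribbon_refold:
  assumes inj: "inj_on z {1..l}" and k: "1 \<le> k" "k \<le> l" and S: "S \<subseteq> {1..l-1}"
    and W: "rooted A (ribbon_towards l k z \<union> Y) r"
    and sub: "z ` {1..l} \<subseteq> A" and Y: "Y \<inter> z ` {1..l} \<times> z ` {1..l} = {}"
    and P: "P = generated_poset A (ribbon_covers l S z \<union> Y)"
  shows "\<exists>F. F \<subseteq> covers P \<and> (\<exists>r. rooted (fst P) (covers P - F \<union> F\<inverse>) r) \<and>
    (\<exists>vs. vs \<noteq> [] \<and> distinct vs \<and> set vs \<subseteq> fst P \<and> steps vs \<subseteq> covers P \<union> (covers P)\<inverse> \<and>
       F \<subseteq> steps vs \<union> (steps vs)\<inverse>)"
proof -
  define Z where "Z = ribbon_covers l S z"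
  define Zk where "Zk = ribbon_towards l k z"
  define N where "N = steps (map z [1..<Suc l])"
  note injD = inj_on_eq_iff[OF inj]
  have N: "N = {(z i, z (Suc i)) | i. 1 \<le> i \<and> i < l}" unfolding N_def by (rule steps_ribbon)
  have "Z \<union> Z\<inverse> = N \<union> N\<inverse>" "Zk \<union> Zk\<inverse> = N \<union> N\<inverse>"
  proof -
    have "(z i, z (Suc i)) \<in> Z \<union> Z\<inverse>" if "1 \<le> i" "i < l" for i
      using that by (auto simp: Z_def ribbon_covers_def)
    moreover have "Z \<subseteq> N \<union> N\<inverse>" using S k by (auto simp: Z_def ribbon_covers_def N; force)
    ultimately show "Z \<union> Z\<inverse> = N \<union> N\<inverse>" unfolding N by blast
    have "(z i, z (Suc i)) \<in> Zk \<union> Zk\<inverse>" if "1 \<le> i" "i < l" for i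
      using that by (cases "i < k") (auto simp: Zk_def ribbon_towards_def)
    moreover have "Zk \<subseteq> N \<union> N\<inverse>" using k by (auto simp: Zk_def ribbon_towards_def N; force)
    ultimately show "Zk \<union> Zk\<inverse> = N \<union> N\<inverse>" unfolding N by blast
  qed
  note ZN = this
  let ?X = "Z \<union> Y" and ?W = "Zk \<union> Y"
  \<comment> \<open>\<open>?X\<close> and \<open>?W\<close> orient the same undirected graph, so the
    bridge property and connectedness pass from the rooted tree \<open>?W\<close> to
    \<open>?X\<close>.\<close>
  have sym_eq: "?X \<union> ?X\<inverse> = ?W \<union> ?W\<inverse>" using ZN by blast
  have otW: "oriented_tree A ?W" using W unfolding Zk_def by (rule rooted_imp_oriented_tree)
  then have asW: "?W \<inter> ?W\<inverse> = {}" by (simp add: oriented_tree_def oriented_forest_def)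
  have asZ: "Z \<inter> Z\<inverse> = {}"
  proof -
    have ZE: "\<exists>i. 1 \<le> i \<and> i < l \<and>
        (i \<in> S \<and> x = z (Suc i) \<and> y = z i \<or> i \<notin> S \<and> x = z i \<and> y = z (Suc i))"
      if "(x, y) \<in> Z" for x y
      using that S k unfolding Z_def ribbon_covers_def by fastforce
    \<comment> \<open>By injectivity of \<open>z\<close>, opposite pairs would have to come from the
      same index \<open>i\<close>, and whether \<open>i\<close> lies in \<open>S\<close> admits only
      one direction.\<close>
    have "(y, x) \<notin> Z" if "(x, y) \<in> Z" for x y
    proof
      assume "(y, x) \<in> Z"
      with ZE[OF that] ZE[of y x] obtain i j where ij: "1 \<le> i" "i < l" "1 \<le> j" "j < l"
        "i \<in> S \<and> x = z (Suc i) \<and> y = z i \<or> i \<notin> S \<and> x = z i \<and> y = z (Suc i)"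
        "j \<in> S \<and> y = z (Suc j) \<and> x = z j \<or> j \<notin> S \<and> y = z j \<and> x = z (Suc j)"
        by blast
      moreover have "z i = z j \<longleftrightarrow> i = j" "z (Suc i) = z j \<longleftrightarrow> Suc i = j" "z i = z (Suc j) \<longleftrightarrow> i = Suc j"
        using ij(1-4) by (auto intro!: injD)
      moreover have "\<not> (i = Suc j \<and> Suc i = j)" by simp
      ultimately show False by metis
    qed
    then show ?thesis by blast
  qed
  have Zz: "Z \<union> Z\<inverse> \<subseteq> z ` {1..l} \<times> z ` {1..l}" unfolding ZN(1) N by auto
  have asX: "?X \<inter> ?X\<inverse> = {}"
    using asW asZ Zz Y by blast
  have "?X \<subseteq> ?W \<union> ?W\<inverse>" using sym_eq by blast
  then have "?X \<subseteq> A \<times> A" using otW unfolding oriented_tree_def by blast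
  then have otX: "oriented_tree A ?X"
    using otW asX unfolding oriented_tree_def oriented_forest_def sym_eq by simp
  then have cov: "covers P = ?X"
    unfolding P Z_def[symmetric] oriented_tree_def by (intro covers_generated_poset) blast+
  have fst: "fst P = A" by (simp add: P generated_poset_def)
  \<comment> \<open>\<open>Y\<close> belongs to both orientations, so only ribbon edges remain in
    \<open>?F\<close>.\<close>
  let ?F = "?X - ?W"
  have "?X - ?F \<union> ?F\<inverse> = ?W"
    using sym_eq asX asW by (rule fold_diff)
  then have "rooted A (?X - ?F \<union> ?F\<inverse>) r" using W Zk_def by simp
  moreover have "?F \<subseteq> N \<union> N\<inverse>" using ZN by blast
  moreover have "N \<subseteq> ?X \<union> ?X\<inverse>" using ZN by blast
  moreover have "distinct (map z [1..<Suc l])"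
    using inj by (simp add: distinct_map atLeastLessThanSuc_atLeastAtMost del: upt_Suc)
  moreover have "map z [1..<Suc l] \<noteq> []" using k by simp
  moreover have "set (map z [1..<Suc l]) \<subseteq> A"
    using sub by (simp add: atLeastLessThanSuc_atLeastAtMost del: upt_Suc)
  ultimately show ?thesis
    unfolding cov fst N_def
    by (intro exI[of _ ?F] conjI exI[of _ r] exI[of _ "map z [1..<Suc l]"]) blast+
qed

lemma snd_tree_poset: "tree_poset T \<Longrightarrow> snd T = Id_on (fst T) \<union> (covers T)\<^sup>+"
  using generated_poset_covers[of T] by (auto simp: tree_poset_def generated_poset_def prod_eq_iff)

text \<open>The orders of the ribbon and of the trees follow from their covers, so these together
  with the connecting edges generate the same poset. The trees are indexed by pairs in a single
  union to suit \<open>rooted_glue_family\<close>.\<close>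

lemma attach_below_conv:
  assumes "\<And>i j. i \<in> {1..l} \<Longrightarrow> j < m i \<Longrightarrow> tree_poset (T i j)"
  shows "attach_below (ribbon l S z) l z m T = generated_poset
    (z ` {1..l} \<union> (\<Union>p\<in>(SIGMA i:{1..l}. {..<m i}). fst (T (fst p) (snd p))))
    (ribbon_covers l S z \<union> (\<Union>p\<in>(SIGMA i:{1..l}. {..<m i}).
       covers (T (fst p) (snd p)) \<union> {(poset_root (T (fst p) (snd p)), z (fst p))}))"
    (is "_ = generated_poset ?A ?X")
proof -
  let ?B = "fst (ribbon l S z) \<union> (\<Union>i\<in>{1..l}. \<Union>j\<in>{..<m i}. fst (T i j))"
  let ?Y = "snd (ribbon l S z) \<union>
    (\<Union>i\<in>{1..l}. \<Union>j\<in>{..<m i}. snd (T i j) \<union> {(poset_root (T i j), z i)})"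
  have A: "?B = ?A" by (auto simp: ribbon_conv generated_poset_def)
  have T: "snd (T i j) = Id_on (fst (T i j)) \<union> (covers (T i j))\<^sup>+" if "i \<in> {1..l}" "j < m i" for i j
    using assms that by (intro snd_tree_poset)
  have "generated_poset ?A ?X = generated_poset ?A ?Y"
  proof (rule generated_poset_cong)
    show "?X \<subseteq> ?Y"
    proof (intro Un_least UN_least)
      show "ribbon_covers l S z \<subseteq> ?Y" by (auto simp: ribbon_conv generated_poset_def)
    next
      fix p assume "p \<in> (SIGMA i:{1..l}. {..<m i})"
      then obtain i j where p: "p = (i, j)" "i \<in> {1..l}" "j \<in> {..<m i}" by auto
      have "snd (T i j) \<union> {(poset_root (T i j), z i)} \<subseteq> ?Y" using p(2,3) by blast
      moreover have "covers (T i j) \<subseteq> snd (T i j)" by (auto simp: covers_def)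
      ultimately show "covers (T (fst p) (snd p)) \<subseteq> ?Y"
        and "{(poset_root (T (fst p) (snd p)), z (fst p))} \<subseteq> ?Y"
        unfolding p fst_conv snd_conv by blast+
    qed
    show "?Y \<subseteq> Id_on ?A \<union> ?X\<^sup>+"
    proof (intro Un_least UN_least)
      have "(ribbon_covers l S z)\<^sup>+ \<subseteq> ?X\<^sup>+" by (rule trancl_mono_subset) blast
      then show "snd (ribbon l S z) \<subseteq> Id_on ?A \<union> ?X\<^sup>+"
        by (auto simp: ribbon_conv generated_poset_def)
    next
      fix i j assume ij: "i \<in> {1..l}" "j \<in> {..<m i}"
      then have p: "(i, j) \<in> (SIGMA i:{1..l}. {..<m i})" by blast
      have sub: "covers (T i j) \<subseteq> ?X" and "(poset_root (T i j), z i) \<in> ?X"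
        using UN_upper[OF p, of "\<lambda>p. covers (T (fst p) (snd p)) \<union> {(poset_root (T (fst p) (snd p)), z (fst p))}"]
        by auto
      then show "{(poset_root (T i j), z i)} \<subseteq> Id_on ?A \<union> ?X\<^sup>+" by blast
      have "fst (T i j) \<subseteq> ?A" using UN_upper[OF p, of "\<lambda>p. fst (T (fst p) (snd p))"] by auto
      then have "Id_on (fst (T i j)) \<subseteq> Id_on ?A" by blast
      with trancl_mono_subset[OF sub] show "snd (T i j) \<subseteq> Id_on ?A \<union> ?X\<^sup>+"
        using T ij by (simp only: lessThan_iff) blast
    qed
  qed
  then show ?thesis unfolding attach_below_def A by (rule sym)
qed

lemma attach_above_conv:
  assumes B: "B = generated_poset A X" and Q: "tree_poset Q"
  shows "attach_above B x Q q = generated_poset (A \<union> fst Q) (X \<union> covers Q \<union> {(x, q)})"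
proof -
  have sQ: "snd Q = Id_on (fst Q) \<union> (covers Q)\<^sup>+" using Q by (rule snd_tree_poset)
  have "X\<^sup>+ \<subseteq> (X \<union> covers Q \<union> {(x, q)})\<^sup>+" "(covers Q)\<^sup>+ \<subseteq> (X \<union> covers Q \<union> {(x, q)})\<^sup>+"
    by (auto intro!: trancl_mono_subset)
  then have "generated_poset (A \<union> fst Q) (X \<union> covers Q \<union> {(x, q)}) =
      generated_poset (A \<union> fst Q) (Id_on A \<union> X\<^sup>+ \<union> snd Q \<union> {(x, q)})"
    unfolding sQ by (intro generated_poset_cong) (auto dest: subsetD)
  then show ?thesis by (simp add: attach_above_def B generated_poset_def)
qed

text \<open>The ribbon is refolded towards the vertex that carries \<open>Q\<close>, or towards
  \<open>z 1\<close> if there is no \<open>Q\<close>. The trees below already point to the ribbon,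
  and \<open>Q\<close> leads on to its own root.\<close>

lemma mobile_imp_fold_path:
  assumes "mobile_tree_poset P"
  shows "\<exists>F. F \<subseteq> covers P \<and> (\<exists>r. rooted (fst P) (covers P - F \<union> F\<inverse>) r) \<and>
    (\<exists>vs. vs \<noteq> [] \<and> distinct vs \<and> set vs \<subseteq> fst P \<and> steps vs \<subseteq> covers P \<union> (covers P)\<inverse> \<and>
       F \<subseteq> steps vs \<union> (steps vs)\<inverse>)"
proof -
  from assms obtain l S z m T where l: "1 \<le> l" and S: "S \<subseteq> {1..l-1}" and inj: "inj_on z {1..l}"
    and T: "\<And>i j. i \<in> {1..l} \<Longrightarrow> j < m i \<Longrightarrow> rooted_tree_poset (T i j)"
      "\<And>i j. i \<in> {1..l} \<Longrightarrow> j < m i \<Longrightarrow> fst (T i j) \<inter> z ` {1..l} = {}"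
    and dis: "disjoint_family_on (\<lambda>(i, j). fst (T i j)) (SIGMA i:{1..l}. {..<m i})"
    and P: "P = attach_below (ribbon l S z) l z m T \<or>
        (\<exists>k\<in>{1..l}. \<exists>Q. \<exists>q\<in>fst Q. rooted_tree_poset Q \<and>
           fst Q \<inter> fst (attach_below (ribbon l S z) l z m T) = {} \<and>
           P = attach_above (attach_below (ribbon l S z) l z m T) (z k) Q q)"
    unfolding mobile_tree_poset_def Let_def by blast
  define Z where "Z = z ` {1..l}"
  define I where "I = (SIGMA i:{1..l}. {..<m i})"
  define A where "A = Z \<union> (\<Union>p\<in>I. fst (T (fst p) (snd p)))"
  define Y where "Y = (\<Union>p\<in>I. covers (T (fst p) (snd p)) \<union> {(poset_root (T (fst p) (snd p)), z (fst p))})"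
  have B: "attach_below (ribbon l S z) l z m T = generated_poset A (ribbon_covers l S z \<union> Y)"
    unfolding A_def Y_def Z_def I_def
    using T(1) by (intro attach_below_conv) (auto simp: rooted_tree_poset_def)
  have TI: "rooted (fst (T (fst p) (snd p))) (covers (T (fst p) (snd p))) (poset_root (T (fst p) (snd p)))"
    "Z \<inter> fst (T (fst p) (snd p)) = {}" "z (fst p) \<in> Z" if "p \<in> I" for p
  proof -
    have p: "fst p \<in> {1..l}" "snd p < m (fst p)" using that by (auto simp: I_def)
    show "rooted (fst (T (fst p) (snd p))) (covers (T (fst p) (snd p))) (poset_root (T (fst p) (snd p)))"
      using T(1)[OF p] by (rule rooted_tree_poset_imp_rooted)
    show "Z \<inter> fst (T (fst p) (snd p)) = {}" "z (fst p) \<in> Z"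
      using T(2)[OF p] p(1) unfolding Z_def by blast+
  qed
  have W: "rooted A (ribbon_towards l k z \<union> Y) (z k)" if "k \<in> {1..l}" for k
    unfolding A_def Y_def
  proof (rule rooted_glue_family)
    show "finite I" by (simp add: I_def)
    show "rooted Z (ribbon_towards l k z) (z k)"
      unfolding Z_def using inj that by (intro rooted_ribbon_towards) auto
    show "disjoint_family_on (\<lambda>p. fst (T (fst p) (snd p))) I"
      using dis by (simp add: I_def case_prod_unfold)
  qed (use TI in auto)
  have Y: "Y \<inter> Z \<times> Z = {}"
  proof -
    have "x \<notin> Z" if "(x, y) \<in> Y" for x y
    proof -
      from that obtain p where p: "p \<in> I" "x \<in> fst (T (fst p) (snd p))"
        using TI(1) unfolding Y_def rooted_def by blast
      with TI(2) show ?thesis by blast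
    qed
    then show ?thesis by blast
  qed
  have ZA: "Z \<subseteq> A" by (simp add: A_def)
  from P show ?thesis
  proof
    assume "P = attach_below (ribbon l S z) l z m T"
    then show ?thesis
      using ribbon_refold[OF inj order.refl l S W[of 1] ZA[unfolded Z_def] Y[unfolded Z_def]] l
      unfolding B by simp
  next
    assume "\<exists>k\<in>{1..l}. \<exists>Q. \<exists>q\<in>fst Q. rooted_tree_poset Q \<and>
       fst Q \<inter> fst (attach_below (ribbon l S z) l z m T) = {} \<and>
       P = attach_above (attach_below (ribbon l S z) l z m T) (z k) Q q"
    then obtain k Q q where k: "k \<in> {1..l}" and q: "q \<in> fst Q" and Q: "rooted_tree_poset Q"
      and QB: "fst Q \<inter> fst (attach_below (ribbon l S z) l z m T) = {}"
      and P: "P = attach_above (attach_below (ribbon l S z) l z m T) (z k) Q q" by blast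
    let ?Y = "Y \<union> covers Q \<union> {(z k, q)}"
    have QA: "fst Q \<inter> A = {}" using QB by (simp add: B generated_poset_def)
    have rQ: "rooted (fst Q) (covers Q) (poset_root Q)" using Q by (rule rooted_tree_poset_imp_rooted)
    \<comment> \<open>Here \<open>Q\<close> is the upper tree: all the rest, rooted at
      \<open>z k\<close>, is hung below \<open>q\<close>.\<close>
    from rooted_glue[OF this W[OF k] QA q]
    have W': "rooted (A \<union> fst Q) (ribbon_towards l k z \<union> ?Y) (poset_root Q)"
      by (simp add: Un_ac insert_commute)
    have Y': "?Y \<inter> Z \<times> Z = {}"
    proof -
      have "covers Q \<subseteq> fst Q \<times> fst Q" using rQ by (simp add: rooted_def)
      then show ?thesis using Y QA ZA q by blast
    qed
    have P': "P = generated_poset (A \<union> fst Q) (ribbon_covers l S z \<union> ?Y)"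
      using attach_above_conv[OF B, of Q "z k" q] Q P by (simp add: rooted_tree_poset_def Un_ac)
    have "1 \<le> k" "k \<le> l" "z ` {1..l} \<subseteq> A \<union> fst Q" using k ZA by (auto simp: Z_def)
    then show ?thesis using ribbon_refold[OF inj _ _ S W' _ Y'[unfolded Z_def] P'] by blast
  qed
qed

section \<open>A fold along a path yields a mobile tree poset\<close>

text \<open>An upward path from a vertex of \<open>B\<close> cannot leave \<open>B\<close> before
  reaching \<open>c\<close>. This serves both the downset of a vertex and the set of vertices not
  below the ribbon.\<close>

lemma rooted_restrict:
  assumes R: "rooted A R r" and B: "B \<subseteq> A" "c \<in> B"
    and reach: "\<And>u. u \<in> B \<Longrightarrow> (u, c) \<in> R\<^sup>*"
    and closed: "\<And>u v. u \<in> B \<Longrightarrow> u \<noteq> c \<Longrightarrow> (u, v) \<in> R \<Longrightarrow> v \<in> B"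
  shows "rooted B (R \<inter> B \<times> B) c"
proof (rule rootedI)
  show "finite B" using R B by (auto simp: rooted_def intro: finite_subset)
  show "single_valued (R \<inter> B \<times> B)"
    using R by (auto simp: rooted_def intro: single_valued_subset[of _ R])
  have ac: "acyclic R" using R by (rule rooted_acyclic)
  show "c \<notin> Domain (R \<inter> B \<times> B)"
    using reach acyclic_rtrancl_trancl[OF ac, of _ c] by blast
  show "(x, c) \<in> (R \<inter> B \<times> B)\<^sup>*" if "x \<in> B" for x
  proof -
    have "x \<in> B \<longrightarrow> (x, c) \<in> (R \<inter> B \<times> B)\<^sup>*"
      using reach[OF that]
    proof (induction rule: converse_rtrancl_induct)
      case (step u v)
      show ?case
      proof
        assume u: "u \<in> B"
        show "(u, c) \<in> (R \<inter> B \<times> B)\<^sup>*"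
        proof (cases "u = c")
          case False
          then have "v \<in> B" using closed u step by blast
          with u step show ?thesis by (auto intro: converse_rtrancl_into_rtrancl)
        qed simp
      qed
    qed simp
    with that show ?thesis by blast
  qed
qed (use B in auto)

text \<open>A vertex below \<open>c\<close> other than \<open>c\<close> has a unique parent, which
  therefore lies on its way to \<open>c\<close>.\<close>

lemma rooted_downset:
  assumes R: "rooted A R r" and "c \<in> A"
  defines "D \<equiv> {u. (u, c) \<in> R\<^sup>*}"
  shows "rooted D (R \<inter> D \<times> D) c"
proof (rule rooted_restrict[OF R])
  show "D \<subseteq> A"
    using R \<open>c \<in> A\<close> by (auto simp: D_def rooted_def elim: converse_rtranclE)
  show "v \<in> D" if "u \<in> D" "u \<noteq> c" "(u, v) \<in> R" for u v
  proof -
    from that obtain w where "(u, w) \<in> R" "(w, c) \<in> R\<^sup>*"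
      unfolding D_def by (auto elim: converse_rtranclE)
    moreover from this have "w = v" using that R by (auto simp: rooted_def dest: single_valuedD)
    ultimately show ?thesis by (simp add: D_def)
  qed
qed (auto simp: D_def)

text \<open>The pieces are read off from the fold \<open>R'\<close>, where going up is
  deterministic: the path is the ribbon, the downsets \<open>D c\<close> of its children
  \<open>c\<close> off the path are attached below, and the vertices \<open>U\<close> not below the
  path form \<open>Q\<close>.\<close>

lemma fold_path_imp_mobile:
  assumes tp: "tree_poset P" and F: "F \<subseteq> covers P"
    and root: "rooted (fst P) (covers P - F \<union> F\<inverse>) r"
    and vs: "vs \<noteq> []" "distinct vs" "set vs \<subseteq> fst P" "steps vs \<subseteq> covers P \<union> (covers P)\<inverse>"
    and FN: "F \<subseteq> steps vs \<union> (steps vs)\<inverse>"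
  shows "mobile_tree_poset P"
proof -
  define A where "A = fst P"
  define R where "R = covers P"
  define R' where "R' = R - F \<union> F\<inverse>"
  define E where "E = R \<union> R\<inverse>"
  define N where "N = steps vs"
  define Z where "Z = set vs"
  have "oriented_tree A R"
    unfolding A_def R_def using tp by (rule tree_poset_imp_oriented_tree)
  then have RA: "R \<subseteq> A \<times> A" and br: "bridges E" and as: "R \<inter> R\<inverse> = {}"
    by (auto simp: oriented_tree_def oriented_forest_def E_def)
  have FR: "F \<subseteq> R" using F by (simp add: R_def)
  have E': "E = R' \<union> R'\<inverse>" unfolding E_def R'_def using FR by auto
  have symE: "sym E" by (auto simp: E_def sym_def)
  have rt: "rooted A R' r" using root by (simp add: A_def R'_def R_def)
  have ac: "acyclic R'" using rt by (rule rooted_acyclic)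
  have sv: "single_valued R'" and R'A: "R' \<subseteq> A \<times> A" and rD: "r \<notin> Domain R'" and rA: "r \<in> A"
    and reach: "\<And>x. x \<in> A \<Longrightarrow> (x, r) \<in> R'\<^sup>*" and finA: "finite A"
    using rt by (auto simp: rooted_def)

  \<comment> \<open>Position of the path within the fold\<close>
  have NE: "N \<subseteq> E" and ZA: "Z \<subseteq> A" and hdZ: "hd vs \<in> Z" using vs by (auto simp: N_def E_def R_def Z_def A_def)
  have NZ: "N \<subseteq> Z \<times> Z" by (simp add: N_def Z_def steps_subset_set)
  \<comment> \<open>\<open>F\<close> lies on the path, so folding changes nothing off the
    path.\<close>
  have off: "(x, y) \<in> R \<longleftrightarrow> (x, y) \<in> R'" if "(x, y) \<notin> N \<union> N\<inverse>" for x y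
    using that FN by (auto simp: R'_def N_def)
  \<comment> \<open>Deleting an edge that is not a step of the path leaves the path
    connected.\<close>
  have Zconn: "(x, y) \<in> (E - {(a, b), (b, a)})\<^sup>*"
    if "x \<in> Z" "y \<in> Z" "(a, b) \<notin> N \<union> N\<inverse>" for x y a b
  proof -
    have "N \<subseteq> E - {(a, b), (b, a)}" using NE that by auto
    then have "(hd vs, x) \<in> (E - {(a, b), (b, a)})\<^sup>*" "(hd vs, y) \<in> (E - {(a, b), (b, a)})\<^sup>*"
      using that(1,2) unfolding N_def Z_def by (auto intro: steps_rtrancl)
    then show ?thesis by (meson rtrancl_trans sym_rtrancl_minus_edge symE)
  qed
  \<comment> \<open>Any other edge between two path vertices would be bypassed by the path.\<close>
  have ZZ: "(x, y) \<in> N \<union> N\<inverse>" if "(x, y) \<in> E" "x \<in> Z" "y \<in> Z" for x y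
    using Zconn[OF that(2,3), of x y] bridgesD[OF br that(1)] by blast
  \<comment> \<open>After deletion of the edge from \<open>c\<close> to \<open>p\<close>, which is
    not on the path, the path is still connected and cannot leave the downset of \<open>c\<close>.
    So it lies below \<open>c\<close> entirely or not at all.\<close>
  have Zdown: "(y, c) \<in> R'\<^sup>*"
    if "(c, p) \<in> R'" "c \<notin> Z \<or> p \<notin> Z" "x \<in> Z" "y \<in> Z" "(x, c) \<in> R'\<^sup>*" for c p x y
  proof -
    have "(c, p) \<notin> N \<union> N\<inverse>" using that(2) NZ by blast
    from Zconn[OF that(3,4) this] show ?thesis
      unfolding E' using downset_closed_rtrancl[OF sv that(1)] that(5) by blast
  qed
  \<comment> \<open>Otherwise the whole path, and with it the parent \<open>p\<close> of
    \<open>c\<close>, would lie below \<open>c\<close>.\<close>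
  have branch: "(x, c) \<notin> R'\<^sup>*" if "c \<notin> Z" "p \<in> Z" "(c, p) \<in> R'" "x \<in> Z" for c p x
  proof
    assume "(x, c) \<in> R'\<^sup>*"
    then have "(p, c) \<in> R'\<^sup>*" using Zdown[of c p x p] that by blast
    then show False using acyclic_rtrancl_trancl[OF ac, of p c] that(3) by blast
  qed

  \<comment> \<open>The ribbon\<close>
  define l where "l = length vs"
  \<comment> \<open>Shifts the list positions, which start at 0, to the numbering of the ribbon from
    1.\<close>
  define z where "z i = vs ! (i - 1)" for i
  define S where "S = {i \<in> {1..l-1}. (z (Suc i), z i) \<in> R}"
  have mapz: "map z [1..<Suc l] = vs"
    by (rule nth_equalityI) (auto simp: z_def l_def simp del: upt_Suc)
  have l: "1 \<le> l" using vs(1) by (cases vs) (auto simp: l_def)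
  have zZ: "z ` {1..l} = Z"
    using arg_cong[OF mapz, of set] by (simp add: Z_def atLeastLessThanSuc_atLeastAtMost del: upt_Suc)
  have inj: "inj_on z {1..l}"
    using vs(2) unfolding mapz[symmetric]
    by (simp add: distinct_map atLeastLessThanSuc_atLeastAtMost del: upt_Suc)
  have Nz: "N = {(z i, z (Suc i)) | i. 1 \<le> i \<and> i < l}"
    using steps_ribbon[of z l] unfolding mapz N_def .
  let ?Z = "ribbon_covers l S z"
  have ribbon_sub: "?Z \<subseteq> R"
  proof -
    have "(z i, z (Suc i)) \<in> R" if "i \<in> {1..l-1} - S" for i
    proof -
      have "1 \<le> i" "i < l" using that by auto
      then have "(z i, z (Suc i)) \<in> E" using NE Nz by blast
      then show ?thesis using that by (auto simp: S_def E_def)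
    qed
    then show ?thesis by (auto simp: ribbon_covers_def S_def)
  qed
  have ribbon_sup: "(x, y) \<in> ?Z" if "(x, y) \<in> R" "(x, y) \<in> N \<union> N\<inverse>" for x y
  proof -
    from that(2) obtain i where i: "1 \<le> i" "i < l" "(x, y) = (z i, z (Suc i)) \<or> (x, y) = (z (Suc i), z i)"
      unfolding Nz by auto
    from i(3) show ?thesis
    proof
      assume eq: "(x, y) = (z i, z (Suc i))"
      then have "(z (Suc i), z i) \<notin> R" using that(1) as by blast
      then have "i \<in> {1..l-1} - S" using i by (auto simp: S_def)
      then show ?thesis unfolding eq ribbon_covers_def by blast
    next
      assume eq: "(x, y) = (z (Suc i), z i)"
      then have "i \<in> S" using i that(1) by (auto simp: S_def)
      then show ?thesis unfolding eq ribbon_covers_def by blast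
    qed
  qed

  \<comment> \<open>The trees attached below the ribbon\<close>
  define Ch where "Ch i = {c. c \<notin> Z \<and> (c, z i) \<in> R'}" for i
  \<comment> \<open>The children of \<open>z i\<close> off the path are listed in some order,
    because the attached trees are indexed by numbers.\<close>
  have "\<exists>cs. set cs = Ch i \<and> distinct cs" for i
  proof -
    have "Ch i \<subseteq> A" using R'A by (auto simp: Ch_def)
    then show ?thesis using finA by (meson finite_distinct_list finite_subset)
  qed
  then obtain cl where cl: "\<And>i. set (cl i) = Ch i" "\<And>i. distinct (cl i)" by metis
  define m where "m i = length (cl i)" for i
  define D where "D c = {u. (u, c) \<in> R'\<^sup>*}" for c
  define T where "T i j = generated_poset (D (cl i ! j)) (R' \<inter> D (cl i ! j) \<times> D (cl i ! j))" for i j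
  define I where "I = (SIGMA i:{1..l}. {..<m i})"
  have Crooted: "rooted (D c) (R' \<inter> D c \<times> D c) c" if "c \<in> A" for c
    unfolding D_def using rt that by (rule rooted_downset)
  have clD: "cl i ! j \<notin> Z" "(cl i ! j, z i) \<in> R'" "cl i ! j \<in> A" "z i \<in> Z" if "(i, j) \<in> I" for i j
  proof -
    have "cl i ! j \<in> Ch i" using that unfolding cl(1)[symmetric] by (auto simp: I_def m_def)
    then show "cl i ! j \<notin> Z" "(cl i ! j, z i) \<in> R'" "cl i ! j \<in> A" using R'A by (auto simp: Ch_def)
    show "z i \<in> Z" using that unfolding zZ[symmetric] I_def by blast
  qed
  have T: "rooted_tree_poset (T i j)" "poset_root (T i j) = cl i ! j"
    "covers (T i j) = R' \<inter> D (cl i ! j) \<times> D (cl i ! j)" "fst (T i j) = D (cl i ! j)"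
    if "(i, j) \<in> I" for i j
  proof -
    note rc = Crooted[OF clD(3)[OF that]]
    show "rooted_tree_poset (T i j)" "poset_root (T i j) = cl i ! j"
      unfolding T_def using rooted_generates_rooted_tree_poset[OF rc] .
    show "covers (T i j) = R' \<inter> D (cl i ! j) \<times> D (cl i ! j)"
      unfolding T_def using rooted_imp_oriented_tree[OF rc] unfolding oriented_tree_def
      by (intro covers_generated_poset) blast+
  qed (simp add: T_def generated_poset_def)
  have DZ: "D (cl i ! j) \<inter> Z = {}" if "(i, j) \<in> I" for i j
    using branch[OF clD(1) clD(4) clD(2)] that by (auto simp: D_def)
  have disj: "disjoint_family_on (\<lambda>(i, j). fst (T i j)) I"
  proof -
    have "D (cl i ! j) \<inter> D (cl i' ! j') = {}" if ij: "(i, j) \<in> I" "(i', j') \<in> I" "(i, j) \<noteq> (i', j')" for i j i' j'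
    proof -
      have ne: "cl i ! j \<noteq> cl i' ! j'"
      proof
        assume eq: "cl i ! j = cl i' ! j'"
        then have "z i = z i'" using clD(2)[OF ij(1)] clD(2)[OF ij(2)] sv by (auto dest: single_valuedD)
        moreover have "i \<in> {1..l}" "i' \<in> {1..l}" using ij by (auto simp: I_def)
        ultimately have "i = i'" using inj by (meson inj_onD)
        moreover have "j < length (cl i)" "j' < length (cl i')" using ij by (auto simp: I_def m_def)
        ultimately have "j = j'" using eq cl(2)[of i] by (simp add: nth_eq_iff_index_eq)
        with \<open>i = i'\<close> ij(3) show False by simp
      qed
      \<comment> \<open>If one branch root lay below another, so would its parent, which is on the
        path; but the path is disjoint from the branches.\<close>
      have no: False if ab: "(a, b) \<in> I" "(a', b') \<in> I" "cl a ! b \<noteq> cl a' ! b'"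
        "(cl a ! b, cl a' ! b') \<in> R'\<^sup>*" for a b a' b'
      proof -
        from ab(3,4) obtain w where w: "(cl a ! b, w) \<in> R'" "(w, cl a' ! b') \<in> R'\<^sup>*"
          by (meson converse_rtranclE)
        have "w = z a" using w(1) clD(2)[OF ab(1)] sv by (auto dest: single_valuedD)
        then show False using w(2) DZ[OF ab(2)] clD(4)[OF ab(1)] by (auto simp: D_def)
      qed
      \<comment> \<open>Going up from \<open>u\<close> is deterministic, so of two vertices above it
        one lies below the other.\<close>
      have False if "u \<in> D (cl i ! j)" "u \<in> D (cl i' ! j')" for u
        using that single_valued_confluent[OF sv, of u "cl i ! j" "cl i' ! j'"]
          no[OF ij(1,2) ne] no[OF ij(2,1)] ne by (auto simp: D_def)
      then show ?thesis by blast
    qed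
    then have "fst (T i j) \<inter> fst (T i' j') = {}"
      if "(i, j) \<in> I" "(i', j') \<in> I" "(i, j) \<noteq> (i', j')" for i j i' j'
      using that T(4) by simp
    then show ?thesis unfolding disjoint_family_on_def by (simp add: split_paired_all Ball_def)
  qed
  define C where "C = {c. c \<notin> Z \<and> (\<exists>p\<in>Z. (c, p) \<in> R')}"
  define Y where "Y = (\<Union>p\<in>I. covers (T (fst p) (snd p)) \<union> {(poset_root (T (fst p) (snd p)), z (fst p))})"
  define A1 where "A1 = Z \<union> (\<Union>p\<in>I. fst (T (fst p) (snd p)))"
  have B: "attach_below (ribbon l S z) l z m T = generated_poset A1 (?Z \<union> Y)"
    unfolding A1_def Y_def zZ[symmetric] I_def
  proof (rule attach_below_conv)
    show "tree_poset (T i j)" if "i \<in> {1..l}" "j < m i" for i j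
      using T(1)[of i j] that by (auto simp: I_def rooted_tree_poset_def)
  qed
  have CI: "\<exists>i j. (i, j) \<in> I \<and> cl i ! j = c \<and> z i = p" if c: "c \<notin> Z" "p \<in> Z" "(c, p) \<in> R'" for c p
  proof -
    from c(2) obtain i where i: "i \<in> {1..l}" "p = z i" unfolding zZ[symmetric] by blast
    with c have "c \<in> set (cl i)" by (simp add: cl Ch_def)
    then obtain j where "j < m i" "cl i ! j = c" by (auto simp: m_def in_set_conv_nth)
    with i show ?thesis by (auto simp: I_def)
  qed
  have A1: "A1 = Z \<union> (\<Union>c\<in>C. D c)"
  proof -
    have "(\<Union>p\<in>I. fst (T (fst p) (snd p))) = (\<Union>c\<in>C. D c)"
    proof (intro equalityI UN_least)
      fix p assume "p \<in> I"
      then have p: "(fst p, snd p) \<in> I" by simp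
      then have "cl (fst p) ! snd p \<in> C" using clD[OF p] by (auto simp: C_def)
      then show "fst (T (fst p) (snd p)) \<subseteq> (\<Union>c\<in>C. D c)" using T(4)[OF p] by auto
    next
      fix c assume "c \<in> C"
      then obtain i j where ij: "(i, j) \<in> I" "cl i ! j = c" using CI unfolding C_def by blast
      then have "D c = fst (T (fst (i, j)) (snd (i, j)))" using T(4) by simp
      then show "D c \<subseteq> (\<Union>p\<in>I. fst (T (fst p) (snd p)))" using ij(1) by blast
    qed
    then show ?thesis by (simp add: A1_def)
  qed
  \<comment> \<open>A description of \<open>Y\<close> free of the chosen enumeration: fold edges
    inside a branch, and those from a branch root to the path.\<close>
  have Y_iff: "(x, y) \<in> Y \<longleftrightarrow> (\<exists>c\<in>C. (x, y) \<in> R' \<and> (x \<in> D c \<and> y \<in> D c \<or> x = c \<and> y \<in> Z))" for x y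
  proof
    assume "(x, y) \<in> Y"
    then obtain p where "p \<in> I"
      "(x, y) \<in> covers (T (fst p) (snd p)) \<union> {(poset_root (T (fst p) (snd p)), z (fst p))}"
      unfolding Y_def by blast
    then obtain i j where ij: "(i, j) \<in> I" "(x, y) \<in> covers (T i j) \<union> {(poset_root (T i j), z i)}"
      by (metis prod.collapse)
    have "cl i ! j \<in> C" using clD[OF ij(1)] by (auto simp: C_def)
    moreover have "(x, y) \<in> R' \<and> (x \<in> D (cl i ! j) \<and> y \<in> D (cl i ! j) \<or> x = cl i ! j \<and> y \<in> Z)"
      using ij(2) clD[OF ij(1)] unfolding T[OF ij(1)] by auto
    ultimately show "\<exists>c\<in>C. (x, y) \<in> R' \<and> (x \<in> D c \<and> y \<in> D c \<or> x = c \<and> y \<in> Z)" by blast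
  next
    assume "\<exists>c\<in>C. (x, y) \<in> R' \<and> (x \<in> D c \<and> y \<in> D c \<or> x = c \<and> y \<in> Z)"
    then obtain c where c: "c \<in> C" "(x, y) \<in> R'" "x \<in> D c \<and> y \<in> D c \<or> x = c \<and> y \<in> Z" by blast
    then obtain p where p: "c \<notin> Z" "p \<in> Z" "(c, p) \<in> R'" by (auto simp: C_def)
    then obtain i j where ij: "(i, j) \<in> I" "cl i ! j = c" "z i = p" using CI by blast
    have "x = c \<Longrightarrow> y \<in> Z \<Longrightarrow> y = p" using c(2) p(3) sv by (auto dest: single_valuedD)
    then have "(x, y) \<in> covers (T i j) \<union> {(poset_root (T i j), z i)}"
      using c ij T[OF ij(1)] by auto
    then show "(x, y) \<in> Y" unfolding Y_def using ij(1) by (intro UN_I[of "(i, j)"]) auto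
  qed

  \<comment> \<open>The vertices not below the ribbon\<close>
  define U where "U = {u \<in> A. \<forall>x\<in>Z. (u, x) \<notin> R'\<^sup>*}"
  \<comment> \<open>On the way up from \<open>u\<close>, the last vertex before the path is first
    met is the required \<open>c\<close>.\<close>
  have cover: "\<exists>c\<in>C. u \<in> D c" if u: "u \<in> A" "u \<notin> Z" "u \<notin> U" for u
  proof -
    from u obtain x where x: "x \<in> Z" "(u, x) \<in> R'\<^sup>*" by (auto simp: U_def)
    from x(2) have "u \<notin> Z \<longrightarrow> (\<exists>c\<in>C. u \<in> D c)"
    proof (induction rule: converse_rtrancl_induct)
      case (step u v)
      show ?case
      proof (cases "v \<in> Z")
        case True
        with step show ?thesis by (auto simp: C_def D_def)
      next
        case False
        with step show ?thesis by (auto simp: D_def intro: converse_rtrancl_into_rtrancl)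
      qed
    qed (use x in auto)
    with u show ?thesis by blast
  qed
  have CU: "D c \<inter> U = {}" if "c \<in> C" for c
    using that by (auto simp: C_def D_def U_def) (meson rtrancl_into_rtrancl)
  have DA: "D c \<subseteq> A" if "c \<in> C" for c
  proof -
    have "c \<in> A" using that R'A by (auto simp: C_def)
    from Crooted[OF this] show ?thesis
      using R'A \<open>c \<in> A\<close> by (auto simp: D_def elim: converse_rtranclE)
  qed
  have A1U: "A1 \<inter> U = {}" "A1 \<union> U = A"
  proof -
    show "A1 \<inter> U = {}" using CU unfolding A1 U_def by blast
    show "A1 \<union> U = A" using cover DA ZA unfolding A1 U_def by blast
  qed
  have up: "v \<in> U" if "u \<in> U" "(u, v) \<in> R'" for u v
    using that R'A by (auto simp: U_def intro: converse_rtrancl_into_rtrancl)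
  have Y_sub: "Y \<subseteq> R"
  proof (rule subrelI)
    fix x y assume "(x, y) \<in> Y"
    then obtain c where c: "c \<in> C" "(x, y) \<in> R'" "x \<in> D c" "y \<in> D c \<or> x = c"
      unfolding Y_iff by (auto simp: D_def)
    then have "x \<notin> Z" using branch[of c _ x] by (auto simp: C_def D_def)
    then have "(x, y) \<notin> N \<union> N\<inverse>" using NZ by blast
    then show "(x, y) \<in> R" using off c(2) by blast
  qed
  have U_sub: "R' \<inter> U \<times> U \<subseteq> R"
  proof (rule subrelI)
    fix x y assume xy: "(x, y) \<in> R' \<inter> U \<times> U"
    then have "x \<notin> Z" by (auto simp: U_def)
    then have "(x, y) \<notin> N \<union> N\<inverse>" using NZ by blast
    then show "(x, y) \<in> R" using off xy by blast
  qed
  \<comment> \<open>Besides edges of the ribbon, of the branches with their connections and of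
    \<open>U\<close>, only edges leaving the path upwards in the fold are possible; these depend on
    where \<open>r\<close> lies.\<close>
  have R_cases: "(x, y) \<in> ?Z \<union> Y \<union> (R' \<inter> U \<times> U) \<or> x \<in> Z \<and> y \<notin> Z \<and> (x, y) \<in> R'"
    if xy: "(x, y) \<in> R" for x y
  proof (cases "(x, y) \<in> N \<union> N\<inverse>")
    case True
    then show ?thesis using ribbon_sup xy by blast
  next
    case False
    then have xy': "(x, y) \<in> R'" using off xy by blast
    have "\<not> (x \<in> Z \<and> y \<in> Z)" using ZZ[of x y] False xy by (auto simp: E_def)
    moreover have "(x, y) \<in> Y \<union> (R' \<inter> U \<times> U)" if xZ: "x \<notin> Z"
    proof (cases "y \<in> Z")
      case True
      then have "x \<in> C" using xZ xy' by (auto simp: C_def)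
      then show ?thesis using True xy' Y_iff by blast
    next
      case yZ: False
      show ?thesis
      proof (cases "x \<in> U")
        case True
        then show ?thesis using up xy' by blast
      next
        case False
        have "x \<in> A" using xy RA by blast
        then obtain c where c: "c \<in> C" "x \<in> D c" using cover xZ False by blast
        then have "x \<noteq> c" using yZ xy' sv by (auto simp: C_def dest: single_valuedD)
        then obtain w where "(x, w) \<in> R'" "(w, c) \<in> R'\<^sup>*"
          using c(2) unfolding D_def by (auto elim: converse_rtranclE)
        moreover from this have "w = y" using xy' sv by (auto dest: single_valuedD)
        ultimately have "y \<in> D c" by (simp add: D_def)
        then show ?thesis using c xy' Y_iff by blast
      qed
    qed
    ultimately show ?thesis using xy' by blast
  qed
  have gen: "P = generated_poset A R"
    unfolding A_def R_def using tp by (simp add: tree_poset_def generated_poset_covers)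
  \<comment> \<open>\<open>t\<close> lies below itself, so by \<open>Zdown\<close> the whole path
    lies below \<open>t\<close>.\<close>
  have top_down: "Z \<subseteq> D t" if "t \<in> Z" "q \<notin> Z" "(t, q) \<in> R'" for t q
    using Zdown[of t q t] that by (auto simp: D_def)

  \<comment> \<open>Reassembling \<open>P\<close> from its pieces\<close>
  have "P = attach_below (ribbon l S z) l z m T \<or>
        (\<exists>k\<in>{1..l}. \<exists>Q. \<exists>q\<in>fst Q. rooted_tree_poset Q \<and>
           fst Q \<inter> fst (attach_below (ribbon l S z) l z m T) = {} \<and>
           P = attach_above (attach_below (ribbon l S z) l z m T) (z k) Q q)"
  proof (cases "r \<in> Z")
    case True
    \<comment> \<open>With the root on the path, nothing is left to attach above.\<close>
    have U: "U = {}" using True reach by (auto simp: U_def)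
    have "(x, y) \<in> ?Z \<union> Y" if "(x, y) \<in> R" for x y
    proof -
      have False if t: "x \<in> Z" "y \<notin> Z" "(x, y) \<in> R'"
      proof -
        have "(r, x) \<in> R'\<^sup>*" using top_down[OF t] True by (auto simp: D_def)
        then have "r = x" using rD by (meson Domain.DomainI converse_rtranclE)
        then show False using t rD by blast
      qed
      then show ?thesis using R_cases[OF that] U by blast
    qed
    then have "R = ?Z \<union> Y" using ribbon_sub Y_sub by auto
    moreover have "A = A1" using A1U U by blast
    ultimately show ?thesis using gen B by simp
  next
    case False
    have rU: "r \<in> U" using False rD rA by (auto simp: U_def elim: converse_rtranclE)
    \<comment> \<open>On the way up to \<open>r\<close>, the edge that enters \<open>U\<close>
      starts on the path, since a vertex off the path whose parent lies in \<open>U\<close> lies in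
      \<open>U\<close> itself.\<close>
    have "u \<in> U \<or> (\<exists>t\<in>Z. \<exists>q\<in>U. (t, q) \<in> R')" if "(u, r) \<in> R'\<^sup>*" for u
      using that
    proof (induction rule: converse_rtrancl_induct)
      case (step u v)
      show ?case
      proof (cases "v \<in> U \<and> u \<notin> Z")
        case True
        have "(u, x) \<notin> R'\<^sup>*" if x: "x \<in> Z" for x
        proof
          assume "(u, x) \<in> R'\<^sup>*"
          then obtain w where "(u, w) \<in> R'" "(w, x) \<in> R'\<^sup>*"
            using True x by (metis converse_rtranclE)
          moreover from this have "w = v" using step(1) sv by (auto dest: single_valuedD)
          ultimately show False using True x by (auto simp: U_def)
        qed
        then show ?thesis using step(1) R'A by (auto simp: U_def)
      qed (use step in blast)
    qed (use rU in blast)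
    moreover have "hd vs \<notin> U" using hdZ by (auto simp: U_def)
    ultimately obtain t q where tq: "t \<in> Z" "q \<in> U" "(t, q) \<in> R'"
      using reach hdZ ZA by blast
    have qZ: "q \<notin> Z" using tq(2) by (auto simp: U_def)
    \<comment> \<open>Two exits from the path would each lie below the other by
      \<open>top_down\<close>, so they coincide by acyclicity, and the parent is unique.\<close>
    have uniq: "x = t \<and> y = q" if xy: "x \<in> Z" "y \<notin> Z" "(x, y) \<in> R'" for x y
    proof -
      have "(t, x) \<in> R'\<^sup>*" "(x, t) \<in> R'\<^sup>*"
        using top_down[OF xy] top_down[OF tq(1) qZ tq(3)] xy tq by (auto simp: D_def)
      then have "x = t" using acyclic_rtrancl_trancl[OF ac, of t x] by (metis rtranclD)
      then show ?thesis using xy(3) tq(3) sv by (auto dest: single_valuedD)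
    qed
    let ?Q = "generated_poset U (R' \<inter> U \<times> U)"
    have rQ: "rooted U (R' \<inter> U \<times> U) r"
    proof (rule rooted_restrict[OF rt _ rU])
      show "U \<subseteq> A" by (auto simp: U_def)
      then show "(u, r) \<in> R'\<^sup>*" if "u \<in> U" for u using that reach by blast
    qed (rule up)
    have covQ: "covers ?Q = R' \<inter> U \<times> U"
      using rooted_imp_oriented_tree[OF rQ] unfolding oriented_tree_def
      by (intro covers_generated_poset) blast+
    have fstQ: "fst ?Q = U" by (simp add: generated_poset_def)
    have Q: "rooted_tree_poset ?Q" using rQ by (rule rooted_generates_rooted_tree_poset)
    have tqR: "(t, q) \<in> R" using off[of t q] tq(3) NZ qZ by blast
    have "(x, y) \<in> ?Z \<union> Y \<union> (R' \<inter> U \<times> U) \<union> {(t, q)}" if "(x, y) \<in> R" for x y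
      using R_cases[OF that] uniq by blast
    then have "R = ?Z \<union> Y \<union> (R' \<inter> U \<times> U) \<union> {(t, q)}"
      using ribbon_sub Y_sub U_sub tqR by auto
    then have "P = attach_above (attach_below (ribbon l S z) l z m T) t ?Q q"
      using attach_above_conv[OF B, of ?Q t q] Q gen A1U
      by (simp add: rooted_tree_poset_def covQ fstQ)
    moreover obtain k where k: "k \<in> {1..l}" "t = z k" using tq(1) unfolding zZ[symmetric] by blast
    moreover have "fst ?Q \<inter> fst (attach_below (ribbon l S z) l z m T) = {}"
      unfolding B fstQ using A1U by (auto simp: generated_poset_def)
    ultimately show ?thesis using Q tq(2) fstQ by (metis (no_types, lifting))
  qed
  moreover have "\<forall>i\<in>{1..l}. \<forall>j<m i. rooted_tree_poset (T i j) \<and> fst (T i j) \<inter> z ` {1..l} = {}"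
    unfolding zZ
  proof (intro ballI allI impI)
    fix i j assume "i \<in> {1..l}" "j < m i"
    then have "(i, j) \<in> I" by (simp add: I_def)
    then show "rooted_tree_poset (T i j) \<and> fst (T i j) \<inter> Z = {}" using T(1,4) DZ by simp
  qed
  moreover have "S \<subseteq> {1..l-1}" by (auto simp: S_def)
  ultimately show ?thesis
    unfolding mobile_tree_poset_def Let_def
    using l inj disj[unfolded I_def] by (intro exI[of _ l] exI[of _ S] exI[of _ z] exI[of _ m] exI[of _ T]) blast
qed

section \<open>The characterization\<close>

theorem theorem4p14:
  fixes P :: "'a poset"
  assumes "tree_poset P"
  shows "mobile_tree_poset P \<longleftrightarrow>
    (\<exists>F. F \<subseteq> covers P \<and> rooted_tree_poset (fold_poset P F) \<and> path_graph (component_tree P F))"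
proof
  assume "mobile_tree_poset P"
  from mobile_imp_fold_path[OF this]
  show "\<exists>F. F \<subseteq> covers P \<and> rooted_tree_poset (fold_poset P F) \<and> path_graph (component_tree P F)"
    using rooted_fold_iff[OF assms] component_tree_path_iff[OF assms] by metis
next
  assume "\<exists>F. F \<subseteq> covers P \<and> rooted_tree_poset (fold_poset P F) \<and> path_graph (component_tree P F)"
  then obtain F where F: "F \<subseteq> covers P" "rooted_tree_poset (fold_poset P F)"
    "path_graph (component_tree P F)" by blast
  obtain r where "rooted (fst P) (covers P - F \<union> F\<inverse>) r"
    using F(2) unfolding rooted_fold_iff[OF assms F(1)] by blast
  moreover obtain vs where "vs \<noteq> []" "distinct vs" "set vs \<subseteq> fst P"
    "steps vs \<subseteq> covers P \<union> (covers P)\<inverse>" "F \<subseteq> steps vs \<union> (steps vs)\<inverse>"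
    using F(3) unfolding component_tree_path_iff[OF assms F(1)] by blast
  ultimately show "mobile_tree_poset P" by (rule fold_path_imp_mobile[OF assms F(1)])
qed

end
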